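(* Let $A$ be a real $m\times n$ matrix, let $b$ be an integer with $1\le b<\min(m,n)$, and let $q$ be a non-negative integer. Let $G$ be an $m\times b$ Gaussian random matrix, and let $U$, $T$, $V$ be the factors in the factorization $A=UTV^{*}$ produced from $A,b,q,G$ by the single-step UTV construction described in the context, partitioned as $$U=[U_1\ \ U_2],\qquad V=[V_1\ \ V_2],\qquad T=U^{*}AV=\begin{bmatrix}T_{11}&T_{12}\\ T_{21}&T_{22}\end{bmatrix},\qquad T_{ij}=U_i^{*}AV_j,$$ where $U_1$ and $V_1$ have $b$ columns each. (a) Let $Y=(A^{*}A)^{q}A^{*}G$, and let $Q$ denote an $n\times b$ orthonormal matrix whose columns form a basis for the column space of $Y$. Then the error $\|A-AQQ^{*}\|$ precisely equals the error incurred by the RSVD with $q$ steps of power iteration (as defined in the context, with the same $G$ and $Q$). It holds that $$\|A-AQQ^{*}\|=\|A-U_1T_{11}V_1^{*}\|=\left\|\begin{bmatrix}T_{12}\\ T_{22}\end{bmatrix}\right\|.$$ (b) Let $Z=AY=(AA^{*})^{q+1}G$, and let $W$ denote an $m\times b$ orthonormal matrix whose columns form a basis for the column space of $Z$. If the rank of $A$ is at least $b$, then $$\|A-WW^{*}A\|=\|A-U_1(T_{11}V_1^{*}+T_{12}V_2^{*})\|=\|T_{22}\|.$$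
   Context: Notation. Matrices are real; $B^{*}$ denotes the transpose of $B$. $\|\cdot\|$ is the Euclidean norm on vectors and the corresponding operator (spectral) norm on matrices. A matrix $U$ (possibly rectangular) is called orthonormal if its columns are orthonormal, i.e. $U^{*}U=I$; a square orthonormal matrix is called unitary. A Gaussian random matrix is one whose entries are independent standard normal random variables. Single-step UTV construction (inputs: an $m\times n$ matrix $A$, a block size $b$ with $1\le b<\min(m,n)$, an integer $q\ge 0$, and an $m\times b$ matrix $G$ drawn as a Gaussian random matrix). 1. Form the $n\times b$ sampling matrix $Y=(A^{*}A)^{q}A^{*}G$. 2. Compute an unpivoted (full, Householder) QR factorization $Y=\mathbb{V}R$, where $\mathbb{V}$ is an $n\times n$ unitary matrix and $R$ is an $n\times b$ upper triangular matrix. Write $\mathbb{V}=[\mathbb{V}_1\ \ \mathbb{V}_2]$, where $\mathbb{V}_1$ holds the first $b$ columns of $\mathbb{V}$. 3. Compute a full singular value decomposition of the $m\times b$ matrix $A\mathbb{V}_1$, $$A\mathbb{V}_1=U D V_{\rm small}^{*},$$ where $U$ is $m\times m$ unitary, $D$ is $m\times b$ and diagonal with non-negative, non-increasing diagonal entries, and $V_{\rm small}$ is $b\times b$ unitary. (This SVD is computed via a QR factorization $A\mathbb{V}_1=\mathbb{U}\begin{bmatrix}R_{11}\\0\end{bmatrix}$ with $\mathbb{U}$ an $m\times m$ unitary matrix, followed by an SVD $R_{11}=U_{\rm small}D_{\rm small}V_{\rm small}^{*}$ of the $b\times b$ matrix $R_{11}$, setting $U=\mathbb{U}\begin{bmatrix}U_{\rm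 small}&0\\0&I_{m-b}\end{bmatrix}$ and $D=\begin{bmatrix}D_{\rm small}\\0\end{bmatrix}$.) 4. Set $$V=\mathbb{V}\begin{bmatrix}V_{\rm small}&0\\0&I_{n-b}\end{bmatrix},\qquad T=\bigl[\,D\ \ \ U^{*}A\mathbb{V}_2\,\bigr].$$ Then $A=UTV^{*}$, with $T_{11}=D(1{:}b,1{:}b)$, $T_{21}=0$, $T_{12}=U_1^{*}A\mathbb{V}_2$ and $T_{22}=U_2^{*}A\mathbb{V}_2$. RSVD (randomized SVD) with $q$ steps of power iteration: given the $m\times b$ Gaussian matrix $G$, form $Y=(A^{*}A)^{q}A^{*}G$ and an $n\times b$ orthonormal matrix $Q$ whose columns form a basis for the column space of $Y$; set $B=AQ$; compute an SVD $B=\tilde U\tilde D\hat V^{*}$ with $\tilde U$ an $m\times b$ orthonormal matrix, $\tilde D$ a $b\times b$ diagonal matrix, $\hat V$ a $b\times b$ unitary matrix; set $\tilde V=Q\hat V$. The output is the rank-$b$ approximation $\tilde U\tilde D\tilde V^{*}$ of $A$, and the error incurred by the RSVD is $\|A-\tilde U\tilde D\tilde V^{*}\|$. *)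

theory Defs
  imports
    "HOL-Probability.Probability"
    "Jordan_Normal_Form.DL_Rank"
begin

definition vec_norm2 :: "real Matrix.vec \<Rightarrow> real"
  where "vec_norm2 v = sqrt (v \<bullet> v)"

definition spectral_norm :: "real mat \<Rightarrow> real"
  where "spectral_norm A =
    Sup {vec_norm2 (A *\<^sub>v x) | x. x \<in> carrier_vec (dim_col A) \<and> vec_norm2 x \<le> 1}"

text \<open>Only the columns are required to be orthonormal; the matrix may be rectangular.\<close>

definition orthonormal_mat :: "real mat \<Rightarrow> bool"
  where "orthonormal_mat U \<longleftrightarrow> U\<^sup>T * U = 1\<^sub>m (dim_col U)"

definition unitary_mat :: "nat \<Rightarrow> real mat \<Rightarrow> bool"
  where "unitary_mat n U \<longleftrightarrow> U \<in> carrier_mat n n \<and> orthonormal_mat U"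

definition left_cols :: "nat \<Rightarrow> real mat \<Rightarrow> real mat"
  where "left_cols b A = Matrix.mat (dim_row A) b (\<lambda>(i, j). A $$ (i, j))"

definition right_cols :: "nat \<Rightarrow> real mat \<Rightarrow> real mat"
  where "right_cols b A =
    Matrix.mat (dim_row A) (dim_col A - b) (\<lambda>(i, j). A $$ (i, j + b))"

definition append_cols :: "real mat \<Rightarrow> real mat \<Rightarrow> real mat"
  where "append_cols A B = four_block_mat A B (0\<^sub>m 0 (dim_col A)) (0\<^sub>m 0 (dim_col B))"

text \<open>The predicate \<open>upper_triangular\<close> of the library inspects all \<open>j < i\<close>, hence entries out
  of bounds when there are more rows than columns.\<close>

definition rect_upper_triangular :: "real mat \<Rightarrow> bool"
  where "rect_upper_triangular R \<longleftrightarrow>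
    (\<forall>i < dim_row R. \<forall>j < dim_col R. j < i \<longrightarrow> R $$ (i, j) = 0)"

definition full_QR :: "real mat \<Rightarrow> real mat \<Rightarrow> real mat \<Rightarrow> bool"
  where "full_QR Y V R \<longleftrightarrow>
    unitary_mat (dim_row Y) V \<and>
    R \<in> carrier_mat (dim_row Y) (dim_col Y) \<and> rect_upper_triangular R \<and>
    Y = V * R"

text \<open>Full singular value decomposition of a matrix with at least as many rows as columns.\<close>

definition full_SVD :: "real mat \<Rightarrow> real mat \<Rightarrow> real mat \<Rightarrow> real mat \<Rightarrow> bool"
  where "full_SVD B U D V \<longleftrightarrow>
    unitary_mat (dim_row B) U \<and> unitary_mat (dim_col B) V \<and>
    D \<in> carrier_mat (dim_row B) (dim_col B) \<and> diagonal_mat D \<and>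
    (\<forall>i < dim_col B. 0 \<le> D $$ (i, i)) \<and>
    (\<forall>i j. i \<le> j \<and> j < dim_col B \<longrightarrow> D $$ (j, j) \<le> D $$ (i, i)) \<and>
    B = U * D * V\<^sup>T"

text \<open>Economy-size singular value decomposition of a matrix with at least as many rows as
  columns; no ordering of the singular values is imposed.\<close>

definition thin_SVD :: "real mat \<Rightarrow> real mat \<Rightarrow> real mat \<Rightarrow> real mat \<Rightarrow> bool"
  where "thin_SVD B U D V \<longleftrightarrow>
    U \<in> carrier_mat (dim_row B) (dim_col B) \<and> orthonormal_mat U \<and>
    unitary_mat (dim_col B) V \<and>
    D \<in> carrier_mat (dim_col B) (dim_col B) \<and> diagonal_mat D \<and>
    (\<forall>i < dim_col B. 0 \<le> D $$ (i, i)) \<and>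
    B = U * D * V\<^sup>T"

definition sampling_mat :: "real mat \<Rightarrow> nat \<Rightarrow> real mat \<Rightarrow> real mat"
  where "sampling_mat A q G = (A\<^sup>T * A) ^\<^sub>m q * A\<^sup>T * G"

text \<open>The QR factorization and the singular value decomposition are unique neither in signs nor,
  for rank-deficient or degenerate input, in subspaces; the construction is therefore a relation
  that admits every possible choice of the two factorizations.\<close>

definition utv_step ::
    "real mat \<Rightarrow> nat \<Rightarrow> nat \<Rightarrow> real mat \<Rightarrow> real mat \<Rightarrow> real mat \<Rightarrow> real mat \<Rightarrow> bool"
  where "utv_step A b q G U T V \<longleftrightarrow>
    (\<exists>W R D Vsmall.
      full_QR (sampling_mat A q G) W R \<and>
      full_SVD (A * left_cols b W) U D Vsmall \<and>
      V = W * four_block_mat Vsmall (0\<^sub>m b (dim_col A - b))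
                (0\<^sub>m (dim_col A - b) b) (1\<^sub>m (dim_col A - b)) \<and>
      T = append_cols D (U\<^sup>T * A * right_cols b W))"

text \<open>The construction indeed yields a factorization of \<open>A\<close>, and the blocks of \<open>T\<close> are the
  compressions of \<open>A\<close> to the block columns of \<open>U\<close> and \<open>V\<close>.\<close>

lemma utv_step_factorization:
  assumes A: "A \<in> carrier_mat m n" and G: "G \<in> carrier_mat m b" and b: "b < min m n"
    and utv: "utv_step A b q G U T V"
  defines "U\<^sub>1 \<equiv> left_cols b U" and "U\<^sub>2 \<equiv> right_cols b U"
    and "V\<^sub>1 \<equiv> left_cols b V" and "V\<^sub>2 \<equiv> right_cols b V"
  shows "unitary_mat m U" and "unitary_mat n V" and "A = U * T * V\<^sup>T" and "T = U\<^sup>T * A * V"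
    and "split_block T b b =
      (U\<^sub>1\<^sup>T * A * V\<^sub>1, U\<^sub>1\<^sup>T * A * V\<^sub>2, U\<^sub>2\<^sup>T * A * V\<^sub>1, U\<^sub>2\<^sup>T * A * V\<^sub>2)"
proof -
  from utv obtain W R D S where
    QR: "full_QR (sampling_mat A q G) W R" and
    SVD: "full_SVD (A * left_cols b W) U D S" and
    Veq: "V = W * four_block_mat S (0\<^sub>m b (n - b)) (0\<^sub>m (n - b) b) (1\<^sub>m (n - b))" and
    Teq: "T = append_cols D (U\<^sup>T * A * right_cols b W)"
    using A unfolding utv_step_def by auto
  let ?F = "four_block_mat S (0\<^sub>m b (n - b)) (0\<^sub>m (n - b) b) (1\<^sub>m (n - b))"
  have dims: "dim_row (sampling_mat A q G) = n"
    using A unfolding sampling_mat_def by simp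
  have unitary: "X \<in> carrier_mat k k \<and> X\<^sup>T * X = 1\<^sub>m k" if "unitary_mat k X" for k X
    using that unfolding unitary_mat_def orthonormal_mat_def by (metis carrier_matD(2))
  have "unitary_mat n W" using QR unfolding full_QR_def dims by blast
  then have W: "W \<in> carrier_mat n n" and WW: "W\<^sup>T * W = 1\<^sub>m n" using unitary by blast+
  have W1: "left_cols b W \<in> carrier_mat n b" and W2: "right_cols b W \<in> carrier_mat n (n - b)"
    using W unfolding left_cols_def right_cols_def by auto
  have dB: "dim_row (A * left_cols b W) = m" "dim_col (A * left_cols b W) = b"
    using A W1 by auto
  have U: "U \<in> carrier_mat m m" and UU: "U\<^sup>T * U = 1\<^sub>m m"
    and S: "S \<in> carrier_mat b b" and SS: "S\<^sup>T * S = 1\<^sub>m b"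
    and D: "D \<in> carrier_mat m b" and AW: "A * left_cols b W = U * D * S\<^sup>T"
    using SVD unitary unfolding full_SVD_def dB by blast+
  have F: "?F \<in> carrier_mat n n" using S b by auto
  have V: "V \<in> carrier_mat n n" using W F Veq by auto
  show "unitary_mat m U" using U UU unfolding unitary_mat_def orthonormal_mat_def by auto
  have FF: "?F\<^sup>T * ?F = 1\<^sub>m n"
  proof -
    have "?F\<^sup>T = four_block_mat S\<^sup>T (0\<^sub>m b (n - b)) (0\<^sub>m (n - b) b) (1\<^sub>m (n - b))"
      using S by (subst transpose_four_block_mat[of _ b b _ "n - b" _ "n - b"]) auto
    also have "\<dots> * ?F = four_block_mat (S\<^sup>T * S) (0\<^sub>m b (n - b)) (0\<^sub>m (n - b) b) (1\<^sub>m (n - b))"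
      using S by (subst mult_four_block_mat[of _ b b _ "n - b" _ "n - b" _ _ b _ "n - b"]) auto
    also have "\<dots> = 1\<^sub>m n"
      using b unfolding SS by (intro eq_matI) auto
    finally show ?thesis .
  qed
  have VV: "V\<^sup>T * V = 1\<^sub>m n"
  proof -
    have "V\<^sup>T * V = ?F\<^sup>T * (W\<^sup>T * W) * ?F"
      unfolding Veq transpose_mult[OF W F] using W F
      by (simp add: assoc_mult_mat[of _ n n _ n _ n] del: transpose_four_block_mat)
    also have "\<dots> = 1\<^sub>m n"
      unfolding WW using F FF by (metis right_mult_one_mat transpose_carrier_mat)
    finally show ?thesis .
  qed
  show "unitary_mat n V" using V VV unfolding unitary_mat_def orthonormal_mat_def by auto
  have UU': "U * U\<^sup>T = 1\<^sub>m m"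
    by (rule mat_mult_left_right_inverse[OF _ _ UU]) (use U in auto)
  have VV': "V * V\<^sup>T = 1\<^sub>m n"
    by (rule mat_mult_left_right_inverse[OF _ _ VV]) (use V in auto)
  have Wsplit: "W = four_block_mat (left_cols b W) (right_cols b W) (0\<^sub>m 0 b) (0\<^sub>m 0 (n - b))"
    using W b unfolding left_cols_def right_cols_def by (intro eq_matI) auto
  have Vsplit: "V = four_block_mat (left_cols b W * S) (right_cols b W) (0\<^sub>m 0 b) (0\<^sub>m 0 (n - b))"
  proof -
    have "V = four_block_mat (left_cols b W) (right_cols b W) (0\<^sub>m 0 b) (0\<^sub>m 0 (n - b)) * ?F"
      using Veq Wsplit by simp
    also have "\<dots> = four_block_mat (left_cols b W * S) (right_cols b W) (0\<^sub>m 0 b) (0\<^sub>m 0 (n - b))"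
      using W1 W2 S
      by (subst mult_four_block_mat[of _ n b _ "n - b" _ 0 _ _ b _ "n - b"]) auto
    finally show ?thesis .
  qed
  have UA: "U\<^sup>T * A \<in> carrier_mat m n" using U A by auto
  have top: "U\<^sup>T * A * (left_cols b W * S) = D"
  proof -
    have "U\<^sup>T * A * (left_cols b W * S) = U\<^sup>T * (A * left_cols b W) * S"
      using U A W1 S
      by (simp add: assoc_mult_mat[of _ m m _ n _ b] assoc_mult_mat[of _ m n _ b _ b]
          assoc_mult_mat[of _ m m _ b _ b])
    also have "\<dots> = (U\<^sup>T * U) * D * (S\<^sup>T * S)"
      unfolding AW using U D S
      by (simp add: assoc_mult_mat[of _ m m _ m _ b] assoc_mult_mat[of _ m m _ b _ b]
          assoc_mult_mat[of _ m b _ b _ b])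
    finally show ?thesis using D unfolding UU SS by simp
  qed
  have "U\<^sup>T * A * V = four_block_mat (U\<^sup>T * A) (0\<^sub>m m 0) (0\<^sub>m 0 n) (0\<^sub>m 0 0) *
      four_block_mat (left_cols b W * S) (right_cols b W) (0\<^sub>m 0 b) (0\<^sub>m 0 (n - b))"
  proof -
    have "four_block_mat (U\<^sup>T * A) (0\<^sub>m m 0) (0\<^sub>m 0 n) (0\<^sub>m 0 0) = U\<^sup>T * A"
      using UA by (intro eq_matI) auto
    thus ?thesis using Vsplit by simp
  qed
  also have "\<dots> = four_block_mat (U\<^sup>T * A * (left_cols b W * S)) (U\<^sup>T * A * right_cols b W)
      (0\<^sub>m 0 b) (0\<^sub>m 0 (n - b))"
    using UA W1 W2 S
    by (subst mult_four_block_mat[of _ m n _ 0 _ 0 _ _ b _ "n - b"]) auto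
  also have "\<dots> = T"
    unfolding Teq append_cols_def top using D W2 by auto
  finally show T: "T = U\<^sup>T * A * V" by simp
  have "U * T * V\<^sup>T = (U * U\<^sup>T) * A * (V * V\<^sup>T)"
    unfolding T using U A V
    by (simp add: assoc_mult_mat[of _ m m _ m _ n] assoc_mult_mat[of _ m m _ n _ n]
        assoc_mult_mat[of _ m n _ n _ n])
  thus "A = U * T * V\<^sup>T" using A unfolding UU' VV' by simp
  have dT: "dim_row T = m" "dim_col T = n" using T U A V by auto
  have rows: "Matrix.row (U\<^sub>1\<^sup>T * A) i = Matrix.row (U\<^sup>T * A) i" if "i < b" for i
    using that b U A unfolding U\<^sub>1_def left_cols_def
    by (intro eq_vecI) (auto simp: scalar_prod_def intro!: sum.cong)
  have rows2: "Matrix.row (U\<^sub>2\<^sup>T * A) i = Matrix.row (U\<^sup>T * A) (i + b)" if "i < m - b" for i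
    using that b U A unfolding U\<^sub>2_def right_cols_def
    by (intro eq_vecI) (auto simp: scalar_prod_def intro!: sum.cong)
  have cols: "Matrix.col V\<^sub>1 j = Matrix.col V j" if "j < b" for j
    using that b V unfolding V\<^sub>1_def left_cols_def by (intro eq_vecI) auto
  have cols2: "Matrix.col V\<^sub>2 j = Matrix.col V (j + b)" if "j < n - b" for j
    using that b V unfolding V\<^sub>2_def right_cols_def by (intro eq_vecI) auto
  have d: "U\<^sub>1 \<in> carrier_mat m b" "U\<^sub>2 \<in> carrier_mat m (m - b)"
      "V\<^sub>1 \<in> carrier_mat n b" "V\<^sub>2 \<in> carrier_mat n (n - b)"
    using U V unfolding U\<^sub>1_def U\<^sub>2_def V\<^sub>1_def V\<^sub>2_def left_cols_def right_cols_def by auto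
  have Te: "T $$ (i, j) = Matrix.row (U\<^sup>T * A) i \<bullet> Matrix.col V j" if "i < m" "j < n" for i j
    unfolding T by (rule index_mult_mat(1)) (use that UA V in auto)
  have e: "(P * A * Z) $$ (i, j) = Matrix.row (P * A) i \<bullet> Matrix.col Z j"
    if "i < dim_row P" "j < dim_col Z" for P Z i j
    by (rule index_mult_mat(1)) (use that in auto)
  show "split_block T b b =
      (U\<^sub>1\<^sup>T * A * V\<^sub>1, U\<^sub>1\<^sup>T * A * V\<^sub>2, U\<^sub>2\<^sup>T * A * V\<^sub>1, U\<^sub>2\<^sup>T * A * V\<^sub>2)"
    unfolding split_block_def Let_def prod.inject dT
    by (intro conjI eq_matI; use d b dT in \<open>simp add: e Te rows rows2 cols cols2 del: index_mult_mat(1)\<close>)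
qed

text \<open>The columns of \<open>Q\<close> are \<open>b\<close> orthonormal vectors forming a basis of the column space of
  \<open>Y\<close>. That is possible only if \<open>Y\<close>, which has \<open>b\<close> columns, has full column rank. For a
  rank-deficient \<open>Y\<close> the columns of \<open>Q\<close> instead form an orthonormal basis of some
  \<open>b\<close>-dimensional space containing the column space of \<open>Y\<close>.\<close>

definition orthonormal_basis_mat :: "real mat \<Rightarrow> real mat \<Rightarrow> bool"
  where "orthonormal_basis_mat Y Q \<longleftrightarrow>
    Q \<in> carrier_mat (dim_row Y) (dim_col Y) \<and> orthonormal_mat Q \<and>
    (if vec_space.rank (dim_row Y) Y = dim_col Y
     then vectorspace.basis class_ring
            ((module_vec TYPE(real) (dim_row Y))
              \<lparr>carrier := vec_space.col_space (dim_row Y) Y\<rparr>)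
            (set (cols Q))
     else vec_space.col_space (dim_row Y) Y \<subseteq> vec_space.col_space (dim_row Y) Q)"

text \<open>\<open>rsvd A Q Ut Dt Vt\<close>: the randomized SVD computed from the orthonormal matrix \<open>Q\<close> may return
  the factors of the approximation \<open>Ut * Dt * Vt\<^sup>T\<close> of \<open>A\<close>. The sample enters only through
  \<open>Q\<close>.\<close>

definition rsvd :: "real mat \<Rightarrow> real mat \<Rightarrow> real mat \<Rightarrow> real mat \<Rightarrow> real mat \<Rightarrow> bool"
  where "rsvd A Q Ut Dt Vt \<longleftrightarrow> (\<exists>Vhat. thin_SVD (A * Q) Ut Dt Vhat \<and> Vt = Q * Vhat)"

definition gaussian_mat :: "'w measure \<Rightarrow> nat \<Rightarrow> nat \<Rightarrow> ('w \<Rightarrow> real mat) \<Rightarrow> bool"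
  where "gaussian_mat M m b G \<longleftrightarrow>
    (\<forall>\<omega> \<in> space M. G \<omega> \<in> carrier_mat m b) \<and>
    prob_space.indep_vars M (\<lambda>_. borel) (\<lambda>(i, j) \<omega>. G \<omega> $$ (i, j)) ({..<m} \<times> {..<b}) \<and>
    (\<forall>i < m. \<forall>j < b. distributed M lborel (\<lambda>\<omega>. G \<omega> $$ (i, j)) std_normal_density)"

end

theory Submission
  imports Defs
begin

text \<open>
  Everything rests on one probabilistic fact and on the uniqueness of orthogonal projectors.

  The probabilistic fact concerns \<open>Y = P * G\<close> with \<open>P = (A\<^sup>T * A) ^\<^sub>m q * A\<^sup>T\<close>. For a fixed \<open>k\<close> the
  Gram determinant of \<open>P\<close> times the first \<open>k\<close> columns of \<open>G\<close> is a polynomial in the entries of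
  \<open>G\<close>. A polynomial that does not vanish identically is almost surely nonzero at independent
  atomless arguments (Fubini, one coordinate at a time; \<open>AE_polyfun_nonzero\<close>). Let \<open>k \<le> b\<close> be
  the largest number such that \<open>P * H\<close> has independent columns for some \<open>H\<close> with \<open>k\<close> columns. Almost
  surely the first \<open>k\<close> columns of \<open>Y\<close> are then independent. If \<open>k = b\<close>, then \<open>Y\<close> has full column
  rank. If \<open>k < b\<close>, then no further column \<open>P g\<close> is independent of these \<open>k\<close>, so the columns of
  \<open>Y\<close> span the range of \<open>P\<close>, which is the row space of \<open>A\<close>; moreover \<open>A\<close> then has rank at most \<open>k < b\<close>
  (\<open>gaussian_sample_generic\<close>, \<open>rank_le_if_kernel_transpose_le\<close>). Thus the hypothesis on the
  rank in part (b) guarantees the full-rank case.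

  For part (a), \<open>A * V\<^sub>1 = U\<^sub>1 * T\<^sub>1\<^sub>1\<close> because \<open>T\<^sub>2\<^sub>1 = 0\<close>, so
  \<open>U\<^sub>1 * T\<^sub>1\<^sub>1 * V\<^sub>1\<^sup>T = A * (V\<^sub>1 * V\<^sub>1\<^sup>T)\<close>. The QR factorization puts the columns of \<open>Y\<close> into the span
  of \<open>V\<^sub>1\<close>, and they lie in the span of \<open>Q\<close>. In the full-rank case both projectors coincide
  (\<open>projector_unique\<close>); in the deficient case both projectors fix the whole row space of \<open>A\<close> and
  both errors vanish (\<open>orthonormal_absorbs\<close>). The norm identity follows because the residual is
  \<open>A * V\<^sub>2 * V\<^sub>2\<^sup>T = U * [T\<^sub>1\<^sub>2; T\<^sub>2\<^sub>2] * V\<^sub>2\<^sup>T\<close> and the spectral norm is unchanged by orthonormal factors.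

  For part (b), \<open>Z = A * Y\<close> has full column rank since \<open>A\<close> is injective on the range of \<open>A\<^sup>T\<close>, and
  \<open>Z\<close> factors through \<open>A * V\<^sub>1 = U\<^sub>1 * T\<^sub>1\<^sub>1\<close>. Hence \<open>W * W\<^sup>T = U\<^sub>1 * U\<^sub>1\<^sup>T\<close>, and the residual
  \<open>U\<^sub>2 * U\<^sub>2\<^sup>T * A\<close> equals \<open>U\<^sub>2 * T\<^sub>2\<^sub>2 * V\<^sub>2\<^sup>T\<close>.
\<close>

section \<open>Zeros of polynomials at Gaussian points\<close>

text \<open>Polynomial functions of the coordinates in \<open>I\<close>, generated inductively so that measurability,
  the behaviour of one-variable slices and independence of the other coordinates are all
  one-step inductions.\<close>

inductive polyfun :: "'i set \<Rightarrow> (('i \<Rightarrow> real) \<Rightarrow> real) \<Rightarrow> bool" for I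
  where
    polyfun_const: "polyfun I (\<lambda>_. c)"
  | polyfun_coord: "i \<in> I \<Longrightarrow> polyfun I (\<lambda>x. x i)"
  | polyfun_add: "polyfun I f \<Longrightarrow> polyfun I g \<Longrightarrow> polyfun I (\<lambda>x. f x + g x)"
  | polyfun_mult: "polyfun I f \<Longrightarrow> polyfun I g \<Longrightarrow> polyfun I (\<lambda>x. f x * g x)"

lemma polyfun_sum: "(\<And>a. a \<in> S \<Longrightarrow> polyfun I (f a)) \<Longrightarrow> polyfun I (\<lambda>x. \<Sum>a\<in>S. f a x)"
  by (induction S rule: infinite_finite_induct) (auto intro: polyfun.intros)

lemma polyfun_prod: "(\<And>a. a \<in> S \<Longrightarrow> polyfun I (f a)) \<Longrightarrow> polyfun I (\<lambda>x. \<Prod>a\<in>S. f a x)"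
  by (induction S rule: infinite_finite_induct) (auto intro: polyfun.intros)

lemma polyfun_mat_mult:
  assumes B: "\<And>x. B x \<in> carrier_mat n k" and C: "\<And>x. C x \<in> carrier_mat k l"
    and "\<And>i j. i < n \<Longrightarrow> j < k \<Longrightarrow> polyfun I (\<lambda>x. B x $$ (i, j))"
    and "\<And>i j. i < k \<Longrightarrow> j < l \<Longrightarrow> polyfun I (\<lambda>x. C x $$ (i, j))"
    and "i < n" "j < l"
  shows "polyfun I (\<lambda>x. (B x * C x) $$ (i, j))"
proof -
  have "(B x * C x) $$ (i, j) = (\<Sum>r = 0..<k. B x $$ (i, r) * C x $$ (r, j))" for x
    using B[of x] C[of x] assms(5,6) by (auto simp: scalar_prod_def)
  then show ?thesis
    using assms(3-6) by (auto intro!: polyfun_sum polyfun_mult)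
qed

lemma polyfun_det:
  assumes B: "\<And>x. B x \<in> carrier_mat k k"
    and "\<And>i j. i < k \<Longrightarrow> j < k \<Longrightarrow> polyfun I (\<lambda>x. B x $$ (i, j))"
  shows "polyfun I (\<lambda>x. Determinant.det (B x))"
proof -
  have "Determinant.det (B x) =
      (\<Sum>p | p permutes {0..<k}. signof p * (\<Prod>i = 0..<k. B x $$ (i, p i)))" for x
    using B[of x] unfolding Determinant.det_def by auto
  moreover have "p i < k" if "p permutes {0..<k}" "i < k" for p i
    using permutes_in_image[OF that(1), of i] that(2) by auto
  ultimately show ?thesis
    using assms(2) by (auto intro!: polyfun_sum polyfun_mult polyfun_const polyfun_prod)
qed

lemma polyfun_measurable:
  assumes "polyfun I f" and "sets N = sets borel"
  shows "f \<in> borel_measurable (PiM I (\<lambda>_. N))"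
  using assms(1)
proof induction
  case (polyfun_coord i)
  then show ?case
    using measurable_component_singleton[of i I "\<lambda>_. N"] assms(2) by (simp cong: measurable_cong_sets)
qed auto

lemma polyfun_fix_coord:
  assumes "polyfun (insert i I) f"
  shows "polyfun I (\<lambda>x. f (x(i := c)))"
  using assms
proof induction
  case (polyfun_coord j)
  then show ?case by (cases "j = i") (auto intro: polyfun.intros)
qed (auto intro: polyfun.intros)

lemma polyfun_univariate:
  assumes "polyfun I f"
  shows "\<exists>p. \<forall>t. f (x(i := t)) = poly p t"
  using assms
proof induction
  case (polyfun_const c)
  show ?case by (intro exI[of _ "[:c:]"]) simp
next
  case (polyfun_coord j)
  show ?case by (intro exI[of _ "if j = i then [:0, 1:] else [:x j:]"]) simp
next
  case (polyfun_add f g)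
  then show ?case by (metis poly_add)
next
  case (polyfun_mult f g)
  then show ?case by (metis poly_mult)
qed

lemma polyfun_empty_const:
  assumes "polyfun {} f"
  shows "f x = f y"
  using assms by induction auto

text \<open>Induction on the set of coordinates. Freezing the new coordinate at its value in a point
  where \<open>f\<close> is nonzero leaves a polynomial in the remaining ones that is not identically zero; for almost
  every choice of these, the slice in the new coordinate is a nonzero univariate polynomial, whose
  finitely many roots carry no mass.\<close>

lemma AE_polyfun_nonzero:
  fixes N :: "real measure"
  assumes "finite I" and N: "prob_space N" "sets N = sets borel" "\<And>t. emeasure N {t} = 0"
    and "polyfun I f" and "f x\<^sub>0 \<noteq> 0"
  shows "AE x in PiM I (\<lambda>_. N). f x \<noteq> 0"
  using assms(1,5,6)
proof (induction I arbitrary: f x\<^sub>0 rule: finite_induct)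
  case empty
  have "f x \<noteq> 0" for x
    using empty(2) polyfun_empty_const[OF empty(1), of x x\<^sub>0] by simp
  then show ?case by simp
next
  case (insert i I)
  interpret prob_space N by fact
  interpret product_sigma_finite "\<lambda>_ :: 'a. N"
    by (rule product_sigma_finite.intro) (rule sigma_finite_measure_axioms)
  let ?P = "\<lambda>I. PiM I (\<lambda>_. N)"
  have meas: "f \<in> borel_measurable (?P (insert i I))"
    by (rule polyfun_measurable[OF insert.prems(1) N(2)])
  have "AE x in ?P I. f (x(i := x\<^sub>0 i)) \<noteq> 0"
    using insert.IH[OF polyfun_fix_coord[OF insert.prems(1), of "x\<^sub>0 i"], of x\<^sub>0] insert.prems(2)
    by (simp only: fun_upd_triv not_False_eq_True)
  then have inner: "AE x in ?P I. (\<integral>\<^sup>+ t. indicator {y. f y = 0} (x(i := t)) \<partial>N) = 0"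
  proof eventually_elim
    case (elim x)
    obtain p where p: "f (x(i := t)) = poly p t" for t
      using polyfun_univariate[OF insert.prems(1), of x i] by (elim exE) (rule that, erule spec)
    with elim have "p \<noteq> 0" by auto
    then have fin: "finite {t. poly p t = 0}" by (rule poly_roots_finite)
    have "{t. poly p t = 0} \<in> null_sets N"
    proof -
      have "(\<Union>t\<in>{t. poly p t = 0}. {t}) \<in> null_sets N"
        using fin N(2,3) by (intro null_sets.finite_UN) (auto intro!: null_setsI)
      then show ?thesis by simp
    qed
    then have "(\<integral>\<^sup>+ t. indicator {t. poly p t = 0} t \<partial>N) = 0"
      by (subst nn_integral_indicator) (auto dest: null_setsD1 null_setsD2)
    moreover have "indicator {y. f y = 0} (x(i := t)) = (indicator {t. poly p t = 0} t :: ennreal)" for t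
      using p by (auto simp: indicator_def)
    ultimately show ?case by simp
  qed
  have zeros: "(indicator {y. f y = 0} :: _ \<Rightarrow> ennreal) \<in> borel_measurable (?P (insert i I))"
    using measurable_sets[OF meas, of "{0}"]
    by (subst borel_measurable_indicator_iff) (simp add: vimage_def)
  have "(\<integral>\<^sup>+ y. indicator {y. f y = 0} y \<partial>?P (insert i I)) =
      (\<integral>\<^sup>+ x. (\<integral>\<^sup>+ t. indicator {y. f y = 0} (x(i := t)) \<partial>N) \<partial>?P I)"
    using insert.hyps zeros by (rule product_nn_integral_insert)
  also have "\<dots> = 0"
    using nn_integral_cong_AE[OF inner] by simp
  finally have "AE y in ?P (insert i I). indicator {y. f y = 0} y = (0::ennreal)"
    using nn_integral_0_iff_AE[OF zeros] by blast
  then show ?case by eventually_elim (auto simp: indicator_def split: if_splits)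
qed

text \<open>By independence the entries of a Gaussian matrix have a product law, to which the preceding
  lemma applies.\<close>

lemma gaussian_mat_AE_polyfun_nonzero:
  assumes "prob_space M" and G: "gaussian_mat M m b G" and "0 < m" "0 < b"
    and f: "polyfun ({..<m} \<times> {..<b}) f" and "f x\<^sub>0 \<noteq> 0"
  shows "AE \<omega> in M. f (\<lambda>ij. G \<omega> $$ ij) \<noteq> 0"
proof -
  interpret prob_space M by fact
  let ?I = "{..<m} \<times> {..<b}" and ?X = "\<lambda>(i, j) \<omega>. G \<omega> $$ (i, j)"
  define N where "N = density lborel std_normal_density"
  have N: "prob_space N" "sets N = sets borel" "emeasure N {t} = 0" for t
    unfolding N_def by (auto simp: prob_space_normal_density emeasure_density)
  have dist: "distributed M lborel (?X ij) std_normal_density" if "ij \<in> ?I" for ij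
    using G that unfolding gaussian_mat_def by (auto split: prod.splits)
  have rv: "?X ij \<in> borel_measurable M" if "ij \<in> ?I" for ij
    using distributed_measurable[OF dist[OF that]] by simp
  have law: "distr M borel (?X ij) = N" if "ij \<in> ?I" for ij
    using distributed_distr_eq_density[OF dist[OF that]] unfolding N_def
    by (simp cong: distr_cong)
  have "indep_vars (\<lambda>_. borel) ?X ?I"
    using G unfolding gaussian_mat_def by blast
  then have "distr M (PiM ?I (\<lambda>_. borel)) (\<lambda>\<omega>. \<lambda>ij\<in>?I. ?X ij \<omega>) =
      PiM ?I (\<lambda>ij. distr M borel (?X ij))"
    using indep_vars_iff_distr_eq_PiM'[where I = ?I and M' = "\<lambda>_. borel" and X = ?X] rv assms(3,4) by auto
  also have "\<dots> = PiM ?I (\<lambda>_. N)"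
    using law by (intro PiM_cong) auto
  finally have joint: "distr M (PiM ?I (\<lambda>_. borel)) (\<lambda>\<omega>. \<lambda>ij\<in>?I. ?X ij \<omega>) = PiM ?I (\<lambda>_. N)" .
  have rv_joint: "(\<lambda>\<omega>. \<lambda>ij\<in>?I. ?X ij \<omega>) \<in> M \<rightarrow>\<^sub>M PiM ?I (\<lambda>_. borel)"
    using rv by (intro measurable_restrict)
  have [measurable]: "f \<in> borel_measurable (PiM ?I (\<lambda>_. borel))"
    by (rule polyfun_measurable[OF f]) simp
  have "AE x in PiM ?I (\<lambda>_. N). f x \<noteq> 0"
    using AE_polyfun_nonzero[OF _ N f assms(6)] by simp
  then have "AE \<omega> in M. f (\<lambda>ij\<in>?I. ?X ij \<omega>) \<noteq> 0"
    unfolding joint[symmetric] by (subst (asm) AE_distr_iff[OF rv_joint]) auto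
  \<comment> \<open>The restriction only changes coordinates outside the matrix, which a polynomial in its entries ignores.\<close>
  moreover have "f (\<lambda>ij\<in>?I. ?X ij \<omega>) = f (\<lambda>ij. G \<omega> $$ ij)" for \<omega>
    using f by induction auto
  ultimately show ?thesis by simp
qed

section \<open>Kernels and Gram matrices\<close>

text \<open>Associativity and transposition with side conditions on dimensions only: the simplifier
  can discharge these, whereas carrier conditions leave the intermediate dimensions to be guessed.\<close>

lemma mult_assoc_dim:
  fixes A B C :: "real mat"
  shows "dim_col A = dim_row B \<Longrightarrow> dim_col B = dim_row C \<Longrightarrow> A * B * C = A * (B * C)"
  by (rule assoc_mult_mat[of _ "dim_row A" "dim_col A" _ "dim_col B" _ "dim_col C"]) auto

lemma mult_mat_vec_assoc_dim:
  fixes A B :: "real mat"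
  shows "dim_col A = dim_row B \<Longrightarrow> dim_col B = dim_vec v \<Longrightarrow> A * B *\<^sub>v v = A *\<^sub>v (B *\<^sub>v v)"
  by (rule assoc_mult_mat_vec[of _ "dim_row A" "dim_col A" _ "dim_col B"]) (auto intro: carrier_vecI)

lemma transpose_mult_dim:
  fixes A B :: "real mat"
  shows "dim_col A = dim_row B \<Longrightarrow> (A * B)\<^sup>T = B\<^sup>T * A\<^sup>T"
  by (rule transpose_mult[of _ "dim_row A" "dim_col A" _ "dim_col B"]) auto

lemmas mat_dim_simps = mult_assoc_dim mult_mat_vec_assoc_dim transpose_mult_dim

lemma mult_mat_zero_vec [simp]: "dim_col (A :: real mat) = k \<Longrightarrow> A *\<^sub>v 0\<^sub>v k = 0\<^sub>v (dim_row A)"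
  by (intro eq_vecI) (auto simp: scalar_prod_def)

lemma vec_eq_if_diff_eq_0:
  fixes u v :: "real Matrix.vec"
  assumes u: "u \<in> carrier_vec n" and v: "v \<in> carrier_vec n" and "u - v = 0\<^sub>v n"
  shows "u = v"
proof (rule eq_vecI)
  show "vec_index u i = vec_index v i" if "i < dim_vec v" for i
    using arg_cong[OF assms(3), of "\<lambda>w. vec_index w i"] that u v by simp
qed (use u v in auto)

lemma mat_eq_if_mult_vec_eq:
  fixes A B :: "real mat"
  assumes A: "A \<in> carrier_mat m n" and B: "B \<in> carrier_mat m n"
    and eq: "\<And>v. v \<in> carrier_vec n \<Longrightarrow> A *\<^sub>v v = B *\<^sub>v v"
  shows "A = B"
proof (rule mat_col_eqI)
  show "Matrix.col A i = Matrix.col B i" if "i < dim_col B" for i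
  proof -
    have col: "C *\<^sub>v unit_vec n i = Matrix.col C i" if "C \<in> carrier_mat m n" for C :: "real mat"
      using that \<open>i < dim_col B\<close> B by (intro eq_vecI) auto
    show ?thesis using eq[of "unit_vec n i"] col[OF A] col[OF B] by simp
  qed
qed (use A B in auto)

lemma scalar_prod_self_nonneg: "0 \<le> v \<bullet> (v :: real Matrix.vec)"
  by (auto simp: scalar_prod_def intro: sum_nonneg)

lemma scalar_prod_self_eq_0:
  fixes v :: "real Matrix.vec"
  assumes "v \<in> carrier_vec n" and "v \<bullet> v = (0 :: real)"
  shows "v = 0\<^sub>v n"
proof (rule eq_vecI)
  have "\<forall>i\<in>{0..<n}. vec_index v i * vec_index v i = 0"
    using assms by (subst sum_nonneg_eq_0_iff[symmetric]) (auto simp: scalar_prod_def)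
  then show "vec_index v i = vec_index (0\<^sub>v n) i" if "i < dim_vec (0\<^sub>v n :: real Matrix.vec)" for i
    using that by auto
qed (use assms in auto)

text \<open>The inner product of \<open>X\<^sup>T X v\<close> with \<open>v\<close> is \<open>|X v|\<^sup>2\<close>.\<close>

lemma kernel_transpose_mult:
  fixes X :: "real mat"
  assumes X: "X \<in> carrier_mat n k" and v: "v \<in> carrier_vec k"
    and "X\<^sup>T *\<^sub>v (X *\<^sub>v v) = 0\<^sub>v k"
  shows "X *\<^sub>v v = 0\<^sub>v n"
proof (rule scalar_prod_self_eq_0)
  show Xv: "X *\<^sub>v v \<in> carrier_vec n" using X v by auto
  show "(X *\<^sub>v v) \<bullet> (X *\<^sub>v v) = 0"
    using transpose_vec_mult_scalar[OF X v Xv] assms(3) v by simp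
qed

definition trivial_kernel :: "real mat \<Rightarrow> bool"
  where "trivial_kernel X \<longleftrightarrow>
    (\<forall>c \<in> carrier_vec (dim_col X). X *\<^sub>v c = 0\<^sub>v (dim_row X) \<longrightarrow> c = 0\<^sub>v (dim_col X))"

lemma trivial_kernelI:
  assumes "X \<in> carrier_mat n k"
    and "\<And>c. c \<in> carrier_vec k \<Longrightarrow> X *\<^sub>v c = 0\<^sub>v n \<Longrightarrow> c = 0\<^sub>v k"
  shows "trivial_kernel X"
  using assms unfolding trivial_kernel_def by auto

lemma trivial_kernelD:
  assumes "trivial_kernel X" "X \<in> carrier_mat n k" "c \<in> carrier_vec k" "X *\<^sub>v c = 0\<^sub>v n"
  shows "c = 0\<^sub>v k"
  using assms unfolding trivial_kernel_def by auto

text \<open>This turns linear independence of the columns into the non-vanishing of a single polynomial in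
  the entries.\<close>

lemma trivial_kernel_iff_det_gram:
  assumes X: "X \<in> carrier_mat n k"
  shows "trivial_kernel X \<longleftrightarrow> Determinant.det (X\<^sup>T * X) \<noteq> 0"
proof -
  note [simp] = carrier_matD[OF X]
  have "X *\<^sub>v c = 0\<^sub>v n \<longleftrightarrow> X\<^sup>T * X *\<^sub>v c = 0\<^sub>v k" if "c \<in> carrier_vec k" for c
    using that kernel_transpose_mult[OF X that] by (auto simp: mat_dim_simps)
  then show ?thesis
    using X det_0_iff_vec_prod_zero_field[of "X\<^sup>T * X" k] unfolding trivial_kernel_def by auto
qed

lemma nonsingular_inverse:
  fixes B :: "real mat"
  assumes B: "B \<in> carrier_mat k k" and "Determinant.det B \<noteq> 0"
  obtains C where "C \<in> carrier_mat k k" "B * C = 1\<^sub>m k" "C * B = 1\<^sub>m k"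
  using det_non_zero_imp_unit[OF assms, of "()"] that
  unfolding Units_def ring_mat_def by auto

lemma trivial_kernel_square_inverse:
  assumes B: "B \<in> carrier_mat k k" and "trivial_kernel B"
  obtains C where "C \<in> carrier_mat k k" "B * C = 1\<^sub>m k" "C * B = 1\<^sub>m k"
proof -
  have "Determinant.det B \<noteq> 0"
    using det_0_iff_vec_prod_zero_field[OF B] trivial_kernelD[OF assms(2) B] by blast
  then show thesis using nonsingular_inverse[OF B] that by blast
qed

section \<open>Orthonormal columns and their projectors\<close>

lemma orthonormal_matD: "orthonormal_mat Q \<Longrightarrow> Q \<in> carrier_mat n k \<Longrightarrow> Q\<^sup>T * Q = 1\<^sub>m k"
  unfolding orthonormal_mat_def by auto

text \<open>The second factor is \<open>Q = P * F\<close> for a square \<open>F\<close>, because \<open>C\<close> is invertible. Orthonormality of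
  both sides forces \<open>F\<^sup>T * F = 1\<close>, hence \<open>F * F\<^sup>T = 1\<close>, so \<open>F\<close> cancels in \<open>Q * Q\<^sup>T\<close>.\<close>

lemma projector_unique:
  assumes X: "X \<in> carrier_mat n k" "trivial_kernel X"
    and P: "P \<in> carrier_mat n k" "orthonormal_mat P" and B: "B \<in> carrier_mat k k" "X = P * B"
    and Q: "Q \<in> carrier_mat n k" "orthonormal_mat Q" and C: "C \<in> carrier_mat k k" "X = Q * C"
  shows "P * P\<^sup>T = Q * Q\<^sup>T"
proof -
  note [simp] = carrier_matD[OF P(1)] carrier_matD[OF Q(1)] carrier_matD[OF B(1)] carrier_matD[OF C(1)]
  have "trivial_kernel C"
  proof (rule trivial_kernelI[OF C(1)])
    fix c assume c: "c \<in> carrier_vec k" and "C *\<^sub>v c = 0\<^sub>v k"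
    then have "X *\<^sub>v c = 0\<^sub>v n" by (simp add: C(2) mat_dim_simps)
    then show "c = 0\<^sub>v k" using trivial_kernelD[OF X(2,1) c] by blast
  qed
  then obtain D where D: "D \<in> carrier_mat k k" "C * D = 1\<^sub>m k"
    using trivial_kernel_square_inverse[OF C(1)] by blast
  note [simp] = carrier_matD[OF D(1)]
  define F where "F = B * D"
  have F: "F \<in> carrier_mat k k" using B(1) D(1) unfolding F_def by auto
  note [simp] = carrier_matD[OF F]
  have "Q = Q * (C * D)" using D(2) Q(1) by simp
  also have "\<dots> = (P * B) * D" using B(2) C(2) by (simp add: mult_assoc_dim[symmetric])
  also have "\<dots> = P * F" unfolding F_def by (simp add: mult_assoc_dim)
  finally have QPF: "Q = P * F" .
  have "F\<^sup>T * F = F\<^sup>T * ((P\<^sup>T * P) * F)"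
    using F unfolding orthonormal_matD[OF P(2,1)] by simp
  also have "\<dots> = Q\<^sup>T * Q" unfolding QPF by (simp add: mat_dim_simps)
  also have "\<dots> = 1\<^sub>m k" by (rule orthonormal_matD[OF Q(2,1)])
  finally have "F * F\<^sup>T = 1\<^sub>m k"
    using mat_mult_left_right_inverse[of "F\<^sup>T" k F] F by auto
  moreover have "Q * Q\<^sup>T = P * (F * F\<^sup>T) * P\<^sup>T" unfolding QPF by (simp add: mat_dim_simps)
  ultimately show ?thesis using P(1) by simp
qed

text \<open>The vector \<open>x - Q Q\<^sup>T x\<close> is orthogonal to the columns of \<open>Q\<close>, a fortiori to those of \<open>Q * C\<close>, so
  \<open>A\<close> annihilates it.\<close>

lemma orthonormal_absorbs:
  assumes A: "A \<in> carrier_mat m n"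
    and Q: "Q \<in> carrier_mat n k" "orthonormal_mat Q" and C: "C \<in> carrier_mat k l"
    and ker: "\<And>v. v \<in> carrier_vec n \<Longrightarrow> (Q * C)\<^sup>T *\<^sub>v v = 0\<^sub>v l \<Longrightarrow> A *\<^sub>v v = 0\<^sub>v m"
  shows "A * (Q * Q\<^sup>T) = A"
proof (rule mat_eq_if_mult_vec_eq)
  note [simp] = carrier_matD[OF A] carrier_matD[OF Q(1)] carrier_matD[OF C]
  fix x :: "real Matrix.vec" assume x: "x \<in> carrier_vec n"
  then have [simp]: "dim_vec x = n" by auto
  let ?y = "Q *\<^sub>v (Q\<^sup>T *\<^sub>v x)"
  have y: "?y \<in> carrier_vec n" using Q(1) x by auto
  have Qx: "Q\<^sup>T *\<^sub>v x \<in> carrier_vec k" using Q(1) x by auto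
  have "Q\<^sup>T *\<^sub>v ?y = (Q\<^sup>T * Q) *\<^sub>v (Q\<^sup>T *\<^sub>v x)" by (simp add: mat_dim_simps)
  also have "\<dots> = Q\<^sup>T *\<^sub>v x" unfolding orthonormal_matD[OF Q(2,1)] using Qx by simp
  finally have Qy: "Q\<^sup>T *\<^sub>v ?y = Q\<^sup>T *\<^sub>v x" .
  have "(Q * C)\<^sup>T *\<^sub>v (x - ?y) = C\<^sup>T *\<^sub>v (Q\<^sup>T *\<^sub>v (x - ?y))"
    using x y by (simp add: mat_dim_simps)
  also have "Q\<^sup>T *\<^sub>v (x - ?y) = Q\<^sup>T *\<^sub>v x - Q\<^sup>T *\<^sub>v ?y"
    using Q(1) x y by (intro mult_minus_distrib_mat_vec) auto
  also have "\<dots> = 0\<^sub>v k" unfolding Qy using Qx by simp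
  finally have "A *\<^sub>v (x - ?y) = 0\<^sub>v m" using ker[of "x - ?y"] x y by simp
  then have "A *\<^sub>v x - A *\<^sub>v ?y = 0\<^sub>v m"
    using mult_minus_distrib_mat_vec[OF A x y] by simp
  then have "A *\<^sub>v ?y = A *\<^sub>v x"
    by (rule vec_eq_if_diff_eq_0[OF mult_mat_vec_carrier[OF A x] mult_mat_vec_carrier[OF A y], symmetric])
  then show "A * (Q * Q\<^sup>T) *\<^sub>v x = A *\<^sub>v x" by (simp add: mat_dim_simps)
qed (use A Q in auto)

text \<open>A basis of the column space of \<open>Y\<close> spans it, so in both cases of the definition the column space
  of \<open>Y\<close> lies in that of \<open>Q\<close>. Then \<open>Q * Q\<^sup>T\<close> fixes \<open>Y\<close>, and \<open>Q\<^sup>T * Y\<close> collects the coefficients.\<close>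

lemma orthonormal_basis_matD:
  assumes Y: "Y \<in> carrier_mat n k" and basis: "orthonormal_basis_mat Y Q"
  shows "Q \<in> carrier_mat n k" and "orthonormal_mat Q" and "\<exists>C \<in> carrier_mat k k. Y = Q * C"
proof -
  interpret vec_space "TYPE(real)" n .
  note [simp] = carrier_matD[OF Y]
  show Q: "Q \<in> carrier_mat n k" and orth: "orthonormal_mat Q"
    using basis unfolding orthonormal_basis_mat_def by auto
  note [simp] = carrier_matD[OF Q]
  have sub: "col_space Y \<subseteq> col_space Q"
  proof (cases "rank Y = k")
    case True
    let ?S = "set (cols Q)"
    have Ysub: "submodule class_ring (col_space Y) V"
      unfolding col_space_def using Y by (intro span_is_submodule) (auto dest: cols_dim[THEN subsetD])
    have vs: "vectorspace class_ring (vs (col_space Y))"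
      using Y by (intro subspace_is_vs) (simp add: subspace_def Ysub vectorspace_axioms)
    from basis True have "vectorspace.basis class_ring (vs (col_space Y)) ?S"
      unfolding orthonormal_basis_mat_def by simp
    then have "?S \<subseteq> col_space Y" and "LinearCombinations.module.span class_ring (vs (col_space Y)) ?S = col_space Y"
      unfolding vectorspace.basis_def[OF vs] by auto
    then show ?thesis
      using span_li_not_depend(1)[OF _ Ysub] unfolding col_space_def[of Q] by auto
  next
    case False
    then show ?thesis using basis unfolding orthonormal_basis_mat_def by simp
  qed
  have "Q * (Q\<^sup>T * Y) = Y"
  proof (rule mat_eq_if_mult_vec_eq)
    fix v :: "real Matrix.vec" assume v: "v \<in> carrier_vec k"
    then have "Y *\<^sub>v v \<in> col_space Y" unfolding col_space_eq[OF Y] using Y by auto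
    then obtain x where x: "x \<in> carrier_vec k" "Y *\<^sub>v v = Q *\<^sub>v x"
      using sub unfolding col_space_eq[OF Q] by auto
    have "Q * (Q\<^sup>T * Y) *\<^sub>v v = Q *\<^sub>v ((Q\<^sup>T * Q) *\<^sub>v x)"
      using v x by (simp add: mat_dim_simps)
    then show "Q * (Q\<^sup>T * Y) *\<^sub>v v = Y *\<^sub>v v"
      unfolding orthonormal_matD[OF orth Q] using x by simp
  qed (use Q Y in auto)
  then show "\<exists>C \<in> carrier_mat k k. Y = Q * C"
    using Q Y by (intro bexI[of _ "Q\<^sup>T * Y"]) auto
qed

section \<open>Invariance of the spectral norm\<close>

lemma vec_norm2_orthonormal:
  assumes Q: "Q \<in> carrier_mat n k" "orthonormal_mat Q" and v: "v \<in> carrier_vec k"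
  shows "vec_norm2 (Q *\<^sub>v v) = vec_norm2 v"
proof -
  have Qv: "Q *\<^sub>v v \<in> carrier_vec n" using Q v by auto
  have "(Q *\<^sub>v v) \<bullet> (Q *\<^sub>v v) = (Q\<^sup>T *\<^sub>v (Q *\<^sub>v v)) \<bullet> v"
    using transpose_vec_mult_scalar[OF Q(1) v Qv] by simp
  also have "Q\<^sup>T *\<^sub>v (Q *\<^sub>v v) = (Q\<^sup>T * Q) *\<^sub>v v"
    using Q(1) v by (simp add: mat_dim_simps)
  also have "\<dots> = v" unfolding orthonormal_matD[OF Q(2,1)] using v by simp
  finally show ?thesis unfolding vec_norm2_def by simp
qed

text \<open>Bessel's inequality: \<open>|x|\<^sup>2 - |Q\<^sup>T x|\<^sup>2 = |x - Q Q\<^sup>T x|\<^sup>2\<close>.\<close>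

lemma vec_norm2_transpose_orthonormal_le:
  assumes Q: "Q \<in> carrier_mat n k" "orthonormal_mat Q" and x: "x \<in> carrier_vec n"
  shows "vec_norm2 (Q\<^sup>T *\<^sub>v x) \<le> vec_norm2 x"
proof -
  let ?c = "Q\<^sup>T *\<^sub>v x"
  let ?y = "Q *\<^sub>v ?c"
  have c: "?c \<in> carrier_vec k" and y: "?y \<in> carrier_vec n" using Q(1) x by auto
  have cross: "?y \<bullet> x = ?c \<bullet> ?c"
    using transpose_vec_mult_scalar[OF Q(1) c x] comm_scalar_prod[OF x y] by simp
  have norm: "?y \<bullet> ?y = ?c \<bullet> ?c"
    using vec_norm2_orthonormal[OF Q c] unfolding vec_norm2_def by simp
  have "0 \<le> (x - ?y) \<bullet> (x - ?y)" by (rule scalar_prod_self_nonneg)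
  also have "\<dots> = x \<bullet> x - ?c \<bullet> ?c"
    using x y cross norm comm_scalar_prod[OF x y]
    by (simp add: minus_scalar_prod_distrib[of _ n] scalar_prod_minus_distrib[of _ n])
  finally show ?thesis unfolding vec_norm2_def by simp
qed

text \<open>\<open>U\<close> is an isometry, so the two norms are suprema of the same set.\<close>

lemma spectral_norm_orthonormal_mult:
  assumes U: "U \<in> carrier_mat m k" "orthonormal_mat U" and X: "X \<in> carrier_mat k n"
  shows "spectral_norm (U * X) = spectral_norm X"
proof -
  note [simp] = carrier_matD[OF U(1)] carrier_matD[OF X]
  have "vec_norm2 (U * X *\<^sub>v x) = vec_norm2 (X *\<^sub>v x)" if "x \<in> carrier_vec n" for x
    using that vec_norm2_orthonormal[OF U, of "X *\<^sub>v x"] X by (simp add: mat_dim_simps)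
  then have "{vec_norm2 (U * X *\<^sub>v x) | x. x \<in> carrier_vec n \<and> vec_norm2 x \<le> 1} =
      {vec_norm2 (X *\<^sub>v x) | x. x \<in> carrier_vec n \<and> vec_norm2 x \<le> 1}"
    by (intro Collect_cong ex_cong1) auto
  then show ?thesis unfolding spectral_norm_def by simp
qed

text \<open>\<open>V\<^sup>T\<close> maps the unit ball of dimension \<open>n\<close> onto that of dimension \<open>k\<close>: into it by Bessel's
  inequality, and onto it since \<open>y = V\<^sup>T (V y)\<close> with \<open>|V y| = |y|\<close>.\<close>

lemma spectral_norm_mult_transpose_orthonormal:
  assumes V: "V \<in> carrier_mat n k" "orthonormal_mat V" and X: "X \<in> carrier_mat m k"
  shows "spectral_norm (X * V\<^sup>T) = spectral_norm X"
proof -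
  note [simp] = carrier_matD[OF V(1)] carrier_matD[OF X]
  have "{vec_norm2 (X * V\<^sup>T *\<^sub>v x) | x. x \<in> carrier_vec n \<and> vec_norm2 x \<le> 1} =
      {vec_norm2 (X *\<^sub>v y) | y. y \<in> carrier_vec k \<and> vec_norm2 y \<le> 1}" (is "?L = ?R")
  proof (intro equalityI subsetI)
    fix r assume "r \<in> ?L"
    then obtain x where x: "x \<in> carrier_vec n" "vec_norm2 x \<le> 1" and r: "r = vec_norm2 (X * V\<^sup>T *\<^sub>v x)"
      by blast
    have "r = vec_norm2 (X *\<^sub>v (V\<^sup>T *\<^sub>v x))" using r x(1) by (simp add: mat_dim_simps)
    moreover have "V\<^sup>T *\<^sub>v x \<in> carrier_vec k" using V(1) x(1) by auto
    moreover have "vec_norm2 (V\<^sup>T *\<^sub>v x) \<le> 1"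
      using vec_norm2_transpose_orthonormal_le[OF V x(1)] x(2) by simp
    ultimately show "r \<in> ?R" by blast
  next
    fix r assume "r \<in> ?R"
    then obtain y where y: "y \<in> carrier_vec k" "vec_norm2 y \<le> 1" and r: "r = vec_norm2 (X *\<^sub>v y)"
      by blast
    have "X * V\<^sup>T *\<^sub>v (V *\<^sub>v y) = X *\<^sub>v ((V\<^sup>T * V) *\<^sub>v y)"
      using y(1) by (simp add: mat_dim_simps)
    then have "r = vec_norm2 (X * V\<^sup>T *\<^sub>v (V *\<^sub>v y))"
      unfolding orthonormal_matD[OF V(2,1)] using r y(1) by simp
    moreover have "V *\<^sub>v y \<in> carrier_vec n" using V(1) y(1) by auto
    moreover have "vec_norm2 (V *\<^sub>v y) \<le> 1" using vec_norm2_orthonormal[OF V y(1)] y(2) by simp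
    ultimately show "r \<in> ?L" by blast
  qed
  then show ?thesis unfolding spectral_norm_def by simp
qed

section \<open>Rank bounds from kernels\<close>

lemma rank_le_if_col_space_subset:
  assumes A: "A \<in> carrier_mat n k" and B: "B \<in> carrier_mat n l"
    and sub: "vec_space.col_space n A \<subseteq> vec_space.col_space n (B :: real mat)"
  shows "vec_space.rank n A \<le> vec_space.rank n B"
proof -
  interpret vec_space "TYPE(real)" n .
  have "subspace class_ring (col_space C) V" if "C \<in> carrier_mat n j" for C j
    using that cols_dim[of C] unfolding col_space_def by (intro span_is_subspace) auto
  then have "subspace class_ring (col_space A) (vs (col_space B))"
    and vs: "vectorspace class_ring (vs (col_space B))"
    using nested_subspaces[of "col_space B" "col_space A"] sub A B subspace_is_vs by blast+
  then show ?thesis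
    using vectorspace.subspace_dim[OF vs, of "col_space A"]
      fin_dim_span_cols[OF A] fin_dim_span_cols[OF B]
    unfolding rank_def col_space_def by simp
qed

text \<open>The hypothesis says that the rows of \<open>A\<close> lie in the column space of \<open>X\<close>. With \<open>C\<close> the inverse Gram
  matrix of \<open>X\<close>, the projector \<open>X * C * X\<^sup>T\<close> therefore does not change \<open>A\<close>, so \<open>A\<close> factors through
  the \<open>k\<close> columns of \<open>A * X * C\<close>.\<close>

lemma rank_le_if_kernel_transpose_le:
  assumes A: "A \<in> carrier_mat m n" and X: "X \<in> carrier_mat n k" "trivial_kernel X"
    and ker: "\<And>v. v \<in> carrier_vec n \<Longrightarrow> X\<^sup>T *\<^sub>v v = 0\<^sub>v k \<Longrightarrow> A *\<^sub>v v = 0\<^sub>v m"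
  shows "vec_space.rank m A \<le> k"
proof -
  interpret vec_space "TYPE(real)" m .
  note [simp] = carrier_matD[OF A] carrier_matD[OF X(1)]
  obtain C where C: "C \<in> carrier_mat k k" "X\<^sup>T * X * C = 1\<^sub>m k"
    using nonsingular_inverse[of "X\<^sup>T * X" k] X trivial_kernel_iff_det_gram[OF X(1)] by auto
  note [simp] = carrier_matD[OF C(1)]
  let ?B = "A * X * C"
  have B: "?B \<in> carrier_mat m k" using A X C by auto
  have factor: "A *\<^sub>v v = ?B *\<^sub>v (X\<^sup>T *\<^sub>v v)" if v: "v \<in> carrier_vec n" for v
  proof -
    have [simp]: "dim_vec v = n" using v by simp
    let ?y = "X *\<^sub>v (C *\<^sub>v (X\<^sup>T *\<^sub>v v))"
    have y: "?y \<in> carrier_vec n" by (intro carrier_vecI) simp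
    have Xv: "X\<^sup>T *\<^sub>v v \<in> carrier_vec k" using X(1) v by auto
    have "X\<^sup>T *\<^sub>v ?y = (X\<^sup>T * X * C) *\<^sub>v (X\<^sup>T *\<^sub>v v)" by (simp add: mat_dim_simps)
    also have "\<dots> = X\<^sup>T *\<^sub>v v" unfolding C(2) using Xv by simp
    finally have "X\<^sup>T *\<^sub>v (v - ?y) = 0\<^sub>v k"
      using mult_minus_distrib_mat_vec[of "X\<^sup>T" k n v ?y] X(1) v y Xv by simp
    then have "A *\<^sub>v v - A *\<^sub>v ?y = 0\<^sub>v m"
      using ker[of "v - ?y"] mult_minus_distrib_mat_vec[OF A v y] v y by simp
    then have "A *\<^sub>v v = A *\<^sub>v ?y"
      by (rule vec_eq_if_diff_eq_0[OF mult_mat_vec_carrier[OF A v] mult_mat_vec_carrier[OF A y]])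
    also have "\<dots> = ?B *\<^sub>v (X\<^sup>T *\<^sub>v v)" by (simp add: mat_dim_simps)
    finally show ?thesis .
  qed
  have "col_space A \<subseteq> col_space ?B"
  proof
    fix y assume "y \<in> col_space A"
    then obtain v where "v \<in> carrier_vec n" "y = A *\<^sub>v v" unfolding col_space_eq[OF A] by auto
    then have "y = ?B *\<^sub>v (X\<^sup>T *\<^sub>v v)" "X\<^sup>T *\<^sub>v v \<in> carrier_vec k"
      using factor X(1) by auto
    then show "y \<in> col_space ?B" unfolding col_space_eq[OF B] using B by auto
  qed
  then have "rank A \<le> rank ?B" by (rule rank_le_if_col_space_subset[OF A B])
  also have "\<dots> \<le> k" by (rule rank_le_nc[OF B])
  finally show ?thesis .
qed

section \<open>Generic rank of a Gaussian sample\<close>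

lemma left_cols_carrier: "X \<in> carrier_mat n l \<Longrightarrow> left_cols k X \<in> carrier_mat n k"
  unfolding left_cols_def by auto

lemma right_cols_carrier: "X \<in> carrier_mat n l \<Longrightarrow> right_cols k X \<in> carrier_mat n (l - k)"
  unfolding right_cols_def by auto

lemma left_cols_mult:
  fixes X Y :: "real mat"
  assumes "k \<le> dim_col Y" and "dim_col X = dim_row Y"
  shows "left_cols k (X * Y) = X * left_cols k Y"
  using assms unfolding left_cols_def by (intro eq_matI) (auto simp: scalar_prod_def intro!: sum.cong)

lemma right_cols_mult:
  fixes X Y :: "real mat"
  assumes "dim_col X = dim_row Y"
  shows "right_cols k (X * Y) = X * right_cols k Y"
  using assms unfolding right_cols_def by (intro eq_matI) (auto simp: scalar_prod_def intro!: sum.cong)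

lemma kernel_transpose_left_cols:
  assumes X: "X \<in> carrier_mat n l" and "k \<le> l" and v: "v \<in> carrier_vec n"
    and "X\<^sup>T *\<^sub>v v = 0\<^sub>v l"
  shows "(left_cols k X)\<^sup>T *\<^sub>v v = 0\<^sub>v k"
proof (rule eq_vecI)
  fix i assume i: "i < dim_vec (0\<^sub>v k :: real Matrix.vec)"
  then have "vec_index ((left_cols k X)\<^sup>T *\<^sub>v v) i = vec_index (X\<^sup>T *\<^sub>v v) i"
    using X v assms(2) unfolding left_cols_def by (auto simp: scalar_prod_def intro!: sum.cong)
  then show "vec_index ((left_cols k X)\<^sup>T *\<^sub>v v) i = vec_index (0\<^sub>v k) i"
    using i assms(2,4) by simp
qed (simp add: left_cols_def)

text \<open>If \<open>k\<close> columns of \<open>P * H\<close> are independent and no sample achieves \<open>k + 1\<close>, then these columns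
  span the range of \<open>P\<close>. Stated by orthogonality, this reads: \<open>v\<close> orthogonal to \<open>P * H\<close> is orthogonal to
  every \<open>P g\<close>. It is enough to append the single column \<open>g = P\<^sup>T v\<close>, since \<open>v\<close> has inner product
  \<open>|g|\<^sup>2\<close> with \<open>P g\<close>.\<close>

lemma kernel_of_maximal_sample:
  assumes P: "P \<in> carrier_mat n m" and H: "H \<in> carrier_mat m k" "trivial_kernel (P * H)"
    and maximal: "\<And>H'. H' \<in> carrier_mat m (Suc k) \<Longrightarrow> \<not> trivial_kernel (P * H')"
    and v: "v \<in> carrier_vec n" "(P * H)\<^sup>T *\<^sub>v v = 0\<^sub>v k"
  shows "P\<^sup>T *\<^sub>v v = 0\<^sub>v m"
proof -
  note [simp] = carrier_matD[OF P] carrier_matD[OF H(1)]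
  define g where "g = P\<^sup>T *\<^sub>v v"
  have g: "g \<in> carrier_vec m" using P v(1) unfolding g_def by auto
  define H' where "H' = Matrix.mat m (Suc k) (\<lambda>(i, j). if j < k then H $$ (i, j) else vec_index g i)"
  have H': "H' \<in> carrier_mat m (Suc k)" unfolding H'_def by simp
  note [simp] = carrier_matD[OF H']
  have "P * H' \<in> carrier_mat n (Suc k)" using P H' by auto
  with maximal[OF H'] obtain c where c: "c \<in> carrier_vec (Suc k)" "c \<noteq> 0\<^sub>v (Suc k)"
    and Pc: "P * H' *\<^sub>v c = 0\<^sub>v n"
    using trivial_kernelI[of "P * H'"] by blast
  define d where "d = Matrix.vec k (vec_index c)"
  let ?t = "vec_index c k"
  have d: "d \<in> carrier_vec k" unfolding d_def by simp
  have Hd: "H *\<^sub>v d \<in> carrier_vec m" using H(1) d by auto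
  have PHd: "P *\<^sub>v (H *\<^sub>v d) \<in> carrier_vec n" and Pg: "P *\<^sub>v g \<in> carrier_vec n"
    using P Hd g by auto
  have H'c: "H' *\<^sub>v c = H *\<^sub>v d + ?t \<cdot>\<^sub>v g"
    using c(1) g H(1) unfolding H'_def d_def by (intro eq_vecI) (auto simp: scalar_prod_def mult.commute)
  have dep: "P *\<^sub>v (H *\<^sub>v d) + ?t \<cdot>\<^sub>v (P *\<^sub>v g) = 0\<^sub>v n"
  proof -
    have "P * H' *\<^sub>v c = P *\<^sub>v (H' *\<^sub>v c)" using c(1) by (simp add: mat_dim_simps)
    also have "\<dots> = P *\<^sub>v (H *\<^sub>v d) + ?t \<cdot>\<^sub>v (P *\<^sub>v g)"
      unfolding H'c using P Hd g by (simp add: mult_add_distrib_mat_vec[of _ n m] mult_mat_vec[of _ n m])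
    finally show ?thesis using Pc by simp
  qed
  \<comment> \<open>Otherwise the dependence would only involve the independent columns of \<open>P * H\<close>.\<close>
  have "?t \<noteq> 0"
  proof
    assume t: "?t = 0"
    have "P * H *\<^sub>v d = P *\<^sub>v (H *\<^sub>v d) + ?t \<cdot>\<^sub>v (P *\<^sub>v g)"
    proof -
      have "?t \<cdot>\<^sub>v (P *\<^sub>v g) = 0\<^sub>v n" unfolding t using Pg by (intro eq_vecI) auto
      then show ?thesis using d PHd by (simp add: mat_dim_simps)
    qed
    then have "d = 0\<^sub>v k"
      using trivial_kernelD[OF H(2) _ d, of n] P H(1) dep by auto
    then have "vec_index c i = 0" if "i < k" for i
      using that unfolding d_def by (metis index_vec index_zero_vec(1))
    then have "c = 0\<^sub>v (Suc k)" using c(1) t by (intro eq_vecI) (auto simp: less_Suc_eq)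
    with c(2) show False by simp
  qed
  moreover have "?t * (g \<bullet> g) = 0"
  proof -
    have "v \<bullet> (P *\<^sub>v (H *\<^sub>v d)) = ((P * H)\<^sup>T *\<^sub>v v) \<bullet> d"
      using transpose_vec_mult_scalar[of "P * H" n k d v] P H(1) d v(1) by (simp add: mat_dim_simps)
    then have "v \<bullet> (P *\<^sub>v (H *\<^sub>v d)) = 0" using v(2) d by simp
    moreover have "v \<bullet> (P *\<^sub>v g) = g \<bullet> g"
      using transpose_vec_mult_scalar[OF P g v(1)] unfolding g_def by simp
    moreover have "v \<bullet> (P *\<^sub>v (H *\<^sub>v d) + ?t \<cdot>\<^sub>v (P *\<^sub>v g)) = 0"
      unfolding dep using v(1) by simp
    ultimately show ?thesis
      using v(1) PHd Pg by (simp add: scalar_prod_add_distrib[of _ n])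
  qed
  ultimately have "g \<bullet> g = 0" by simp
  then show ?thesis using scalar_prod_self_eq_0[OF g] unfolding g_def by simp
qed

text \<open>The Gram determinant of \<open>P\<close> times the first \<open>k\<close> columns is a polynomial in the entries of the
  sample, and \<open>H\<close> witnesses that it does not vanish identically.\<close>

lemma gaussian_sample_trivial_kernel:
  assumes "prob_space M" and G: "gaussian_mat M m b G" and "0 < m" "0 < b" and k: "k \<le> b"
    and P: "P \<in> carrier_mat n m" and H: "H \<in> carrier_mat m k" "trivial_kernel (P * H)"
  shows "AE \<omega> in M. trivial_kernel (P * left_cols k (G \<omega>))"
proof -
  define E where "E x = Matrix.mat m k x" for x :: "nat \<times> nat \<Rightarrow> real"
  define f where "f x = Determinant.det ((P * E x)\<^sup>T * (P * E x))" for x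
  have E: "E x \<in> carrier_mat m k" for x unfolding E_def by simp
  have PE: "P * E x \<in> carrier_mat n k" for x using P E by simp
  let ?I = "{..<m} \<times> {..<b}"
  have poly_PE: "polyfun ?I (\<lambda>x. (P * E x) $$ (i, j))" if "i < n" "j < k" for i j
    using that k by (intro polyfun_mat_mult[where n = n and k = m and l = k] P E)
      (auto simp: E_def intro!: polyfun.intros)
  have "polyfun ?I f"
    unfolding f_def
  proof (rule polyfun_det)
    show "(P * E x)\<^sup>T * (P * E x) \<in> carrier_mat k k" for x using PE[of x] by auto
    show "polyfun ?I (\<lambda>x. ((P * E x)\<^sup>T * (P * E x)) $$ (i, j))" if "i < k" "j < k" for i j
    proof (rule polyfun_mat_mult[OF _ PE _ poly_PE that])
      show "(P * E x)\<^sup>T \<in> carrier_mat k n" for x using PE[of x] by (rule transpose_carrier_mat[THEN iffD2])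
      show "polyfun ?I (\<lambda>x. (P * E x)\<^sup>T $$ (i, j))" if "i < k" "j < n" for i j
        using poly_PE[OF that(2,1)] index_transpose_mat(1)[of i "P * E _" j] that carrier_matD[OF PE]
        by presburger
    qed
  qed
  moreover have "f (\<lambda>ij. H $$ ij) \<noteq> 0"
  proof -
    have "E (\<lambda>ij. H $$ ij) = H" unfolding E_def using H(1) by (intro eq_matI) auto
    then show ?thesis
      unfolding f_def using H trivial_kernel_iff_det_gram[of "P * H" n k] P by simp
  qed
  ultimately have "AE \<omega> in M. f (\<lambda>ij. G \<omega> $$ ij) \<noteq> 0"
    by (rule gaussian_mat_AE_polyfun_nonzero[OF assms(1-4)])
  then show ?thesis
  proof (rule AE_mp, intro AE_I2 impI)
    fix \<omega> assume "\<omega> \<in> space M" and f: "f (\<lambda>ij. G \<omega> $$ ij) \<noteq> 0"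
    then have "G \<omega> \<in> carrier_mat m b" using G unfolding gaussian_mat_def by blast
    then have "E (\<lambda>ij. G \<omega> $$ ij) = left_cols k (G \<omega>)"
      unfolding E_def left_cols_def by (intro eq_matI) auto
    then show "trivial_kernel (P * left_cols k (G \<omega>))"
      using f trivial_kernel_iff_det_gram[OF PE] unfolding f_def by metis
  qed
qed

text \<open>The alternative is decided by \<open>P\<close> alone, according to whether the largest attainable number \<open>k\<close>
  of independent columns equals \<open>b\<close>. The matrix \<open>X\<close> of the second case is the image of a fixed
  sample; it serves to bound the rank of the matrix from which \<open>P\<close> is built.\<close>

lemma gaussian_sample_generic:
  assumes "prob_space M" and G: "gaussian_mat M m b G" and "0 < m" "0 < b"
    and P: "P \<in> carrier_mat n m"
  shows "(AE \<omega> in M. trivial_kernel (P * G \<omega>)) \<or>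
    (\<exists>k < b. \<exists>X \<in> carrier_mat n k. trivial_kernel X \<and>
      (\<forall>v \<in> carrier_vec n. X\<^sup>T *\<^sub>v v = 0\<^sub>v k \<longrightarrow> P\<^sup>T *\<^sub>v v = 0\<^sub>v m)) \<and>
    (AE \<omega> in M. \<forall>v \<in> carrier_vec n. (P * G \<omega>)\<^sup>T *\<^sub>v v = 0\<^sub>v b \<longrightarrow> P\<^sup>T *\<^sub>v v = 0\<^sub>v m)"
proof -
  let ?K = "{k. k \<le> b \<and> (\<exists>H \<in> carrier_mat m k. trivial_kernel (P * H))}"
  define k where "k = Max ?K"
  have fin: "finite ?K" by simp
  \<comment> \<open>The empty family of columns is independent, so the maximum exists.\<close>
  have "0 \<in> ?K"
    using P by (auto intro!: bexI[of _ "0\<^sub>m m 0"] simp: trivial_kernel_def)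
  then have "k \<in> ?K" using fin Max_in unfolding k_def by blast
  then obtain H where k: "k \<le> b" and H: "H \<in> carrier_mat m k" "trivial_kernel (P * H)" by blast
  note generic = gaussian_sample_trivial_kernel[OF assms(1-4) k P H]
  have Gc: "AE \<omega> in M. G \<omega> \<in> carrier_mat m b" using G unfolding gaussian_mat_def by auto
  show ?thesis
  proof (cases "k = b")
    case True
    have "AE \<omega> in M. trivial_kernel (P * G \<omega>)"
      using generic Gc
    proof eventually_elim
      case (elim \<omega>)
      have "left_cols b (G \<omega>) = G \<omega>"
        using elim(2) unfolding left_cols_def by (intro eq_matI) auto
      then show ?case using elim(1) True by simp
    qed
    then show ?thesis by blast
  next
    case False
    then have kb: "k < b" using k by simp
    have max: "\<not> trivial_kernel (P * H')" if "H' \<in> carrier_mat m (Suc k)" for H'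
    proof
      assume "trivial_kernel (P * H')"
      then have "Suc k \<in> ?K" using that kb by auto
      then show False using Max_ge[OF fin] unfolding k_def by fastforce
    qed
    have "P * H \<in> carrier_mat n k" using P H(1) by auto
    moreover have "\<forall>v \<in> carrier_vec n. (P * H)\<^sup>T *\<^sub>v v = 0\<^sub>v k \<longrightarrow> P\<^sup>T *\<^sub>v v = 0\<^sub>v m"
      using kernel_of_maximal_sample[OF P H max] by blast
    moreover have "AE \<omega> in M. \<forall>v \<in> carrier_vec n. (P * G \<omega>)\<^sup>T *\<^sub>v v = 0\<^sub>v b \<longrightarrow> P\<^sup>T *\<^sub>v v = 0\<^sub>v m"
      using generic Gc
    proof eventually_elim
      case (elim \<omega>)
      show ?case
      proof (intro ballI impI)
        fix v assume v: "v \<in> carrier_vec n" "(P * G \<omega>)\<^sup>T *\<^sub>v v = 0\<^sub>v b"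
        have "left_cols k (P * G \<omega>) = P * left_cols k (G \<omega>)"
          using P elim(2) k by (intro left_cols_mult) auto
        then have "(P * left_cols k (G \<omega>))\<^sup>T *\<^sub>v v = 0\<^sub>v k"
          using kernel_transpose_left_cols[of "P * G \<omega>" n b k v] P elim(2) k v by auto
        then show "P\<^sup>T *\<^sub>v v = 0\<^sub>v m"
          using kernel_of_maximal_sample[OF P left_cols_carrier[OF elim(2)] elim(1) max v(1)] by blast
      qed
    qed
    ultimately show ?thesis using kb H(2) by blast
  qed
qed

section \<open>Power iteration\<close>

lemma power_transpose_mult_range:
  fixes A :: "real mat"
  assumes A: "A \<in> carrier_mat m n" and g: "g \<in> carrier_vec m"
  shows "\<exists>h \<in> carrier_vec m. (A\<^sup>T * A) ^\<^sub>m q *\<^sub>v (A\<^sup>T *\<^sub>v g) = A\<^sup>T *\<^sub>v h"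
  using g
proof (induction q arbitrary: g)
  case 0
  have "A\<^sup>T *\<^sub>v g \<in> carrier_vec n" using A by (intro carrier_vecI) simp
  then show ?case using 0 A by (intro bexI[of _ g]) auto
next
  case (Suc q)
  note [simp] = carrier_matD[OF A]
  have "(A\<^sup>T * A) ^\<^sub>m Suc q *\<^sub>v (A\<^sup>T *\<^sub>v g) = (A\<^sup>T * A) ^\<^sub>m q *\<^sub>v (A\<^sup>T *\<^sub>v (A *\<^sub>v (A\<^sup>T *\<^sub>v g)))"
    using Suc.prems by (simp add: mat_dim_simps)
  moreover have "A *\<^sub>v (A\<^sup>T *\<^sub>v g) \<in> carrier_vec m" by (intro carrier_vecI) simp
  ultimately show ?case using Suc.IH by metis
qed

lemma power_gram_transpose:
  fixes A :: "real mat"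
  assumes A: "A \<in> carrier_mat m n"
  shows "((A\<^sup>T * A) ^\<^sub>m q)\<^sup>T = (A\<^sup>T * A) ^\<^sub>m q"
proof -
  note [simp] = carrier_matD[OF A]
  have commute: "(A\<^sup>T * A) * (A\<^sup>T * A) ^\<^sub>m q = (A\<^sup>T * A) ^\<^sub>m q * (A\<^sup>T * A)" for q
  proof (induction q)
    case (Suc q)
    have "(A\<^sup>T * A) * (A\<^sup>T * A) ^\<^sub>m Suc q = ((A\<^sup>T * A) * (A\<^sup>T * A) ^\<^sub>m q) * (A\<^sup>T * A)"
      by (simp add: mult_assoc_dim)
    then show ?case unfolding Suc by simp
  qed simp
  show ?thesis
  proof (induction q)
    case (Suc q)
    have "((A\<^sup>T * A) ^\<^sub>m Suc q)\<^sup>T = (A\<^sup>T * A) * ((A\<^sup>T * A) ^\<^sub>m q)\<^sup>T"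
      by (simp add: mat_dim_simps)
    then show ?case unfolding Suc commute by simp
  qed simp
qed

text \<open>Each factor \<open>A\<^sup>T * A\<close> can be stripped off because \<open>A\<^sup>T * A\<close> and \<open>A\<close> have the same kernel.\<close>

lemma kernel_power_gram:
  fixes A :: "real mat"
  assumes A: "A \<in> carrier_mat m n" and v: "v \<in> carrier_vec n"
    and "A *\<^sub>v ((A\<^sup>T * A) ^\<^sub>m q *\<^sub>v v) = 0\<^sub>v m"
  shows "A *\<^sub>v v = 0\<^sub>v m"
  using assms(2,3)
proof (induction q arbitrary: v)
  case 0
  then show ?case using A by simp
next
  case (Suc q)
  note [simp] = carrier_matD[OF A]
  let ?u = "A *\<^sub>v v"
  have u: "?u \<in> carrier_vec m" and Au: "A\<^sup>T *\<^sub>v ?u \<in> carrier_vec n"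
    by (intro carrier_vecI; simp)+
  have "A *\<^sub>v ((A\<^sup>T * A) ^\<^sub>m q *\<^sub>v (A\<^sup>T *\<^sub>v ?u)) = 0\<^sub>v m"
    using Suc.prems by (simp add: mat_dim_simps)
  then have "A *\<^sub>v (A\<^sup>T *\<^sub>v ?u) = 0\<^sub>v m" by (rule Suc.IH[OF Au])
  then have "A\<^sup>T *\<^sub>v ?u = 0\<^sub>v n"
    using kernel_transpose_mult[of "A\<^sup>T" n m ?u] A u by simp
  then show ?case by (rule kernel_transpose_mult[OF A Suc.prems(1)])
qed

text \<open>The power iteration does not enlarge the orthogonal complement of the row space of \<open>A\<close>.\<close>

lemma kernel_sampling_transpose:
  fixes A :: "real mat"
  assumes A: "A \<in> carrier_mat m n" and v: "v \<in> carrier_vec n"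
    and "((A\<^sup>T * A) ^\<^sub>m q * A\<^sup>T)\<^sup>T *\<^sub>v v = 0\<^sub>v m"
  shows "A *\<^sub>v v = 0\<^sub>v m"
proof -
  note [simp] = carrier_matD[OF A]
  have "((A\<^sup>T * A) ^\<^sub>m q * A\<^sup>T)\<^sup>T *\<^sub>v v = A *\<^sub>v ((A\<^sup>T * A) ^\<^sub>m q *\<^sub>v v)"
    using v by (simp add: mat_dim_simps power_gram_transpose[OF A])
  then show ?thesis using kernel_power_gram[OF A v] assms(3) by metis
qed

lemma sampling_mat_carrier:
  "A \<in> carrier_mat m n \<Longrightarrow> G \<in> carrier_mat m b \<Longrightarrow> sampling_mat A q G \<in> carrier_mat n b"
  unfolding sampling_mat_def by (intro carrier_matI) auto

text \<open>The columns of \<open>Y\<close> lie in the range of \<open>A\<^sup>T\<close>, on which \<open>A\<close> is injective.\<close>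

lemma trivial_kernel_mult_sampling_mat:
  assumes A: "A \<in> carrier_mat m n" and G: "G \<in> carrier_mat m b"
    and "trivial_kernel (sampling_mat A q G)"
  shows "trivial_kernel (A * sampling_mat A q G)"
proof (rule trivial_kernelI)
  note [simp] = carrier_matD[OF A] carrier_matD[OF G]
  note Y = sampling_mat_carrier[OF A G, of q]
  note [simp] = carrier_matD[OF Y]
  show "A * sampling_mat A q G \<in> carrier_mat m b" using A Y by auto
  fix c assume c: "c \<in> carrier_vec b" and ker: "A * sampling_mat A q G *\<^sub>v c = 0\<^sub>v m"
  have Gc: "G *\<^sub>v c \<in> carrier_vec m" by (intro carrier_vecI) simp
  have "sampling_mat A q G *\<^sub>v c = (A\<^sup>T * A) ^\<^sub>m q *\<^sub>v (A\<^sup>T *\<^sub>v (G *\<^sub>v c))"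
    using c unfolding sampling_mat_def by (simp add: mat_dim_simps)
  then obtain h where h: "h \<in> carrier_vec m" "sampling_mat A q G *\<^sub>v c = A\<^sup>T *\<^sub>v h"
    using power_transpose_mult_range[OF A Gc, of q] by metis
  have "A\<^sup>T\<^sup>T *\<^sub>v (A\<^sup>T *\<^sub>v h) = 0\<^sub>v m" using ker c h(2) by (simp add: mat_dim_simps)
  then have "sampling_mat A q G *\<^sub>v c = 0\<^sub>v n"
    unfolding h(2) using kernel_transpose_mult[of "A\<^sup>T" n m h] A h(1) by simp
  then show "c = 0\<^sub>v b" by (rule trivial_kernelD[OF assms(3) Y c])
qed

section \<open>Blocks of the UTV factorization\<close>

lemma unitary_col_blocks:
  assumes U: "unitary_mat m U" and b: "b \<le> m"
  shows "orthonormal_mat (left_cols b U)" and "orthonormal_mat (right_cols b U)"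
    and "left_cols b U * (left_cols b U)\<^sup>T + right_cols b U * (right_cols b U)\<^sup>T = 1\<^sub>m m"
proof -
  have Uc: "U \<in> carrier_mat m m" and UU: "U\<^sup>T * U = 1\<^sub>m m"
    using U unfolding unitary_mat_def orthonormal_mat_def by auto
  note [simp] = carrier_matD[OF Uc]
  have gram: "(\<Sum>r = 0..<m. U $$ (r, i) * U $$ (r, j)) = (if i = j then 1 else 0)"
    if "i < m" "j < m" for i j
    using arg_cong[OF UU, of "\<lambda>X. X $$ (i, j)"] that by (simp add: scalar_prod_def)
  show "orthonormal_mat (left_cols b U)"
    unfolding orthonormal_mat_def left_cols_def using b gram
    by (intro eq_matI) (auto simp: scalar_prod_def)
  show "orthonormal_mat (right_cols b U)"
    unfolding orthonormal_mat_def right_cols_def using gram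
    by (intro eq_matI) (auto simp: scalar_prod_def)
  have UU': "U * U\<^sup>T = 1\<^sub>m m"
    by (rule mat_mult_left_right_inverse[OF _ _ UU]) (use Uc in auto)
  show "left_cols b U * (left_cols b U)\<^sup>T + right_cols b U * (right_cols b U)\<^sup>T = 1\<^sub>m m"
  proof (rule eq_matI)
    fix i j assume "i < dim_row (1\<^sub>m m :: real mat)" "j < dim_col (1\<^sub>m m :: real mat)"
    then have ij: "i < m" "j < m" by auto
    have "(\<Sum>r = 0..<b. U $$ (i, r) * U $$ (j, r)) + (\<Sum>r = 0..<m - b. U $$ (i, r + b) * U $$ (j, r + b)) =
        (\<Sum>r = 0..<m. U $$ (i, r) * U $$ (j, r))"
      using sum.shift_bounds_nat_ivl[of "\<lambda>r. U $$ (i, r) * U $$ (j, r)" 0 b "m - b"] b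
        sum.atLeastLessThan_concat[of 0 b m "\<lambda>r. U $$ (i, r) * U $$ (j, r)"] by simp
    also have "\<dots> = (1\<^sub>m m :: real mat) $$ (i, j)"
      using arg_cong[OF UU', of "\<lambda>X. X $$ (i, j)"] ij by (simp add: scalar_prod_def)
    finally show "(left_cols b U * (left_cols b U)\<^sup>T + right_cols b U * (right_cols b U)\<^sup>T) $$ (i, j) =
        (1\<^sub>m m :: real mat) $$ (i, j)"
      using ij unfolding left_cols_def right_cols_def by (simp add: scalar_prod_def)
  qed (auto simp: left_cols_def right_cols_def)
qed

text \<open>This block is the lower part of the diagonal factor \<open>D\<close> of the singular value decomposition.\<close>

lemma utv_step_T21_eq_0:
  assumes A: "A \<in> carrier_mat m n" and G: "G \<in> carrier_mat m b" and b: "b < min m n"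
    and utv: "utv_step A b q G U T V"
  shows "(right_cols b U)\<^sup>T * A * left_cols b V = 0\<^sub>m (m - b) b"
proof -
  from utv obtain W R D S where QR: "full_QR (sampling_mat A q G) W R"
    and SVD: "full_SVD (A * left_cols b W) U D S"
    and T: "T = append_cols D (U\<^sup>T * A * right_cols b W)"
    unfolding utv_step_def by blast
  have "W \<in> carrier_mat n n"
    using QR sampling_mat_carrier[OF A G, of q] unfolding full_QR_def unitary_mat_def by auto
  then have "A * left_cols b W \<in> carrier_mat m b" using A left_cols_carrier by auto
  note [simp] = carrier_matD[OF this]
  then have D: "D \<in> carrier_mat m b" "diagonal_mat D" using SVD unfolding full_SVD_def by (auto simp del: index_mult_mat)
  have UAV: "split_block T b b =
      ((left_cols b U)\<^sup>T * A * left_cols b V, (left_cols b U)\<^sup>T * A * right_cols b V,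
       (right_cols b U)\<^sup>T * A * left_cols b V, (right_cols b U)\<^sup>T * A * right_cols b V)"
    by (rule utv_step_factorization(5)[OF A G b utv])
  have "dim_row T = m" using D unfolding T append_cols_def by auto
  then have "(right_cols b U)\<^sup>T * A * left_cols b V = Matrix.mat (m - b) b (\<lambda>(i, j). T $$ (i + b, j))"
    using UAV unfolding split_block_def Let_def by simp
  moreover have "T $$ (i + b, j) = 0" if "i < m - b" "j < b" for i j
    using D that unfolding T append_cols_def diagonal_mat_def by auto
  ultimately show ?thesis by (auto intro!: eq_matI)
qed

text \<open>Rows of \<open>R\<close> beyond the first \<open>b\<close> vanish, so \<open>Y = W\<^sub>1 * R\<^sub>1\<close> for the first \<open>b\<close> columns \<open>W\<^sub>1\<close> of the
  QR factor; the rotation by \<open>S\<close> that turns \<open>W\<^sub>1\<close> into \<open>V\<^sub>1\<close> is absorbed into the coefficients.\<close>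

lemma utv_step_sample_factor:
  assumes A: "A \<in> carrier_mat m n" and G: "G \<in> carrier_mat m b" and b: "b < min m n"
    and utv: "utv_step A b q G U T V"
  shows "\<exists>C \<in> carrier_mat b b. sampling_mat A q G = left_cols b V * C"
proof -
  from utv obtain W R D S where QR: "full_QR (sampling_mat A q G) W R"
    and SVD: "full_SVD (A * left_cols b W) U D S"
    and V: "V = W * four_block_mat S (0\<^sub>m b (n - b)) (0\<^sub>m (n - b) b) (1\<^sub>m (n - b))"
    using A unfolding utv_step_def by auto
  note Y = sampling_mat_carrier[OF A G, of q]
  have W: "W \<in> carrier_mat n n" and R: "R \<in> carrier_mat n b" "rect_upper_triangular R"
    and WR: "sampling_mat A q G = W * R"
    using QR Y unfolding full_QR_def unitary_mat_def by auto
  have W1: "left_cols b W \<in> carrier_mat n b" by (rule left_cols_carrier[OF W])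
  have S: "S \<in> carrier_mat b b" and SS: "S\<^sup>T * S = 1\<^sub>m b"
    using SVD W1 unfolding full_SVD_def unitary_mat_def orthonormal_mat_def by auto
  have SS': "S * S\<^sup>T = 1\<^sub>m b" by (rule mat_mult_left_right_inverse[OF _ _ SS]) (use S in auto)
  note [simp] = carrier_matD[OF W] carrier_matD[OF R(1)] carrier_matD[OF W1] carrier_matD[OF S]
  define R1 where "R1 = Matrix.mat b b (\<lambda>ij. R $$ ij)"
  have R1: "R1 \<in> carrier_mat b b" unfolding R1_def by simp
  note [simp] = carrier_matD[OF R1]
  have tail: "(\<Sum>r = 0..<n. W $$ (i, r) * R $$ (r, j)) = (\<Sum>r = 0..<b. W $$ (i, r) * R $$ (r, j))"
    if "j < b" for i j
    using R(2) that b by (intro sum.mono_neutral_right) (auto simp: rect_upper_triangular_def)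
  have "W * R = left_cols b W * R1"
    using b tail unfolding left_cols_def R1_def by (intro eq_matI) (auto simp: scalar_prod_def)
  also have "\<dots> = left_cols b W * S * (S\<^sup>T * R1)"
  proof -
    have "left_cols b W * S * (S\<^sup>T * R1) = left_cols b W * ((S * S\<^sup>T) * R1)"
      by (simp add: mult_assoc_dim)
    then show ?thesis unfolding SS' using R1 by simp
  qed
  also have "left_cols b W * S = left_cols b V"
  proof -
    have "(\<Sum>r = 0..<n. W $$ (i, r) * (if r < b then S $$ (r, j) else 0)) =
        (\<Sum>r = 0..<b. W $$ (i, r) * S $$ (r, j))" for i j
      using b by (intro sum.mono_neutral_cong_right) auto
    then show ?thesis
      using b unfolding V left_cols_def
      by (intro eq_matI) (auto simp: scalar_prod_def if_distrib cong: if_cong)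
  qed
  finally show ?thesis
    using S R1 unfolding WR by (intro bexI[of _ "S\<^sup>T * R1"]) auto
qed

lemma minus_eq_of_add_eq:
  fixes X Y Z :: "real mat"
  assumes "X \<in> carrier_mat m n" "Y \<in> carrier_mat m n" "X + Y = Z"
  shows "Z - X = Y"
  using assms by (intro eq_matI) auto

text \<open>The part of the analysis that concerns \<open>A\<close> and the factors only, without the sample: both truncations
  are projections of \<open>A\<close>, and the residuals are the discarded blocks of \<open>T\<close> between orthonormal
  factors.\<close>

lemma
  assumes A: "A \<in> carrier_mat m n" and G: "G \<in> carrier_mat m b" and b: "b < min m n"
    and utv: "utv_step A b q G U T V"
    and blocks: "split_block T b b = (T11, T12, T21, T22)"
  shows utv_error_left: "spectral_norm (A - left_cols b U * T11 * (left_cols b V)\<^sup>T) = spectral_norm (T12 @\<^sub>r T22)"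
    and utv_left_approx: "left_cols b U * T11 * (left_cols b V)\<^sup>T = A * (left_cols b V * (left_cols b V)\<^sup>T)"
    and utv_error_both: "spectral_norm (A - left_cols b U * (T11 * (left_cols b V)\<^sup>T + T12 * (right_cols b V)\<^sup>T)) =
      spectral_norm T22"
    and utv_both_approx: "left_cols b U * (T11 * (left_cols b V)\<^sup>T + T12 * (right_cols b V)\<^sup>T) =
      left_cols b U * (left_cols b U)\<^sup>T * A"
    and utv_range: "A * left_cols b V = left_cols b U * T11"
proof -
  define U1 U2 V1 V2 where "U1 = left_cols b U" and "U2 = right_cols b U"
    and "V1 = left_cols b V" and "V2 = right_cols b V"
  note fac = utv_step_factorization[OF A G b utv, folded U1_def U2_def V1_def V2_def]
  have U: "U \<in> carrier_mat m m" and V: "V \<in> carrier_mat n n"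
    using fac(1,2) unfolding unitary_mat_def by auto
  have U1: "U1 \<in> carrier_mat m b" and U2: "U2 \<in> carrier_mat m (m - b)"
    and V1: "V1 \<in> carrier_mat n b" and V2: "V2 \<in> carrier_mat n (n - b)"
    unfolding U1_def U2_def V1_def V2_def
    using left_cols_carrier[OF U] right_cols_carrier[OF U] left_cols_carrier[OF V] right_cols_carrier[OF V]
    by auto
  note [simp] = carrier_matD[OF A] carrier_matD[OF U] carrier_matD[OF V] carrier_matD[OF U1]
    carrier_matD[OF U2] carrier_matD[OF V1] carrier_matD[OF V2]
  have T11: "T11 = U1\<^sup>T * A * V1" and T12: "T12 = U1\<^sup>T * A * V2" and T22: "T22 = U2\<^sup>T * A * V2"
    using fac(5) blocks by auto
  have T22c: "T22 \<in> carrier_mat (m - b) (n - b)" unfolding T22 by (intro carrier_matI) simp_all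
  have T21: "U2\<^sup>T * (A * V1) = 0\<^sub>m (m - b) b"
    using utv_step_T21_eq_0[OF A G b utv] unfolding U2_def[symmetric] V1_def[symmetric]
    by (simp add: mult_assoc_dim)
  have orth: "orthonormal_mat U2" "orthonormal_mat V2"
    and splitU: "U1 * U1\<^sup>T + U2 * U2\<^sup>T = 1\<^sub>m m" and splitV: "V1 * V1\<^sup>T + V2 * V2\<^sup>T = 1\<^sub>m n"
    unfolding U1_def U2_def V1_def V2_def
    using unitary_col_blocks[OF fac(1), of b] unitary_col_blocks[OF fac(2), of b] b by auto
  have splitU': "U1 * (U1\<^sup>T * X) + U2 * (U2\<^sup>T * X) = X" if X: "X \<in> carrier_mat m k" for X k
  proof -
    have "U1 * (U1\<^sup>T * X) + U2 * (U2\<^sup>T * X) = (U1 * U1\<^sup>T + U2 * U2\<^sup>T) * X"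
      using U1 U2 X by (subst add_mult_distrib_mat[of _ m m _ _ k]) (auto simp: mult_assoc_dim)
    then show ?thesis unfolding splitU using X by simp
  qed
  have splitV': "X * (V1 * V1\<^sup>T) + X * (V2 * V2\<^sup>T) = X" if X: "X \<in> carrier_mat k n" for X k
  proof -
    have "X * (V1 * V1\<^sup>T) + X * (V2 * V2\<^sup>T) = X * (V1 * V1\<^sup>T + V2 * V2\<^sup>T)"
      using V1 V2 X by (subst mult_add_distrib_mat[of _ k n _ n]) auto
    then show ?thesis unfolding splitV using X by simp
  qed
  have AV1: "A * V1 \<in> carrier_mat m b" using A V1 by auto
  show range: "A * left_cols b V = left_cols b U * T11"
  proof -
    have "U1 * T11 + U2 * 0\<^sub>m (m - b) b = A * V1"
      using splitU'[OF AV1] unfolding T21 T11 by (simp add: mult_assoc_dim)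
    moreover have "U1 * T11 + U2 * 0\<^sub>m (m - b) b = U1 * T11"
      unfolding T11 using U1 U2 A V1 by (intro eq_matI) auto
    ultimately show ?thesis unfolding U1_def[symmetric] V1_def[symmetric] by simp
  qed
  show left: "left_cols b U * T11 * (left_cols b V)\<^sup>T = A * (left_cols b V * (left_cols b V)\<^sup>T)"
    unfolding range[symmetric] V1_def[symmetric] by (simp add: mult_assoc_dim)
  have res: "A - left_cols b U * T11 * (left_cols b V)\<^sup>T = A * (V2 * V2\<^sup>T)"
    unfolding left unfolding V1_def[symmetric]
    using A V1 V2 by (intro minus_eq_of_add_eq[OF _ _ splitV'[OF A]]) auto
  have stack: "T12 @\<^sub>r T22 = U\<^sup>T * (A * V2)"
  proof -
    have T: "T \<in> carrier_mat m n" using fac(4) U A V by auto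
    have "T12 @\<^sub>r T22 = right_cols b T"
      using blocks T b unfolding split_block_def Let_def append_rows_def right_cols_def
      by (auto intro!: eq_matI)
    also have "\<dots> = U\<^sup>T * (A * V2)"
      unfolding fac(4) V2_def by (simp add: right_cols_mult mult_assoc_dim)
    finally show ?thesis .
  qed
  have orthUt: "orthonormal_mat (U\<^sup>T)"
    using fac(1) mat_mult_left_right_inverse[of "U\<^sup>T" m U] U
    unfolding unitary_mat_def orthonormal_mat_def by auto
  have AV2: "A * V2 \<in> carrier_mat m (n - b)" using A V2 by auto
  have "spectral_norm (A * (V2 * V2\<^sup>T)) = spectral_norm (A * V2)"
    using spectral_norm_mult_transpose_orthonormal[OF V2 orth(2) AV2] by (simp add: mult_assoc_dim)
  also have "\<dots> = spectral_norm (T12 @\<^sub>r T22)"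
    unfolding stack using spectral_norm_orthonormal_mult[OF _ orthUt AV2] U by simp
  finally show "spectral_norm (A - left_cols b U * T11 * (left_cols b V)\<^sup>T) = spectral_norm (T12 @\<^sub>r T22)"
    unfolding res .
  have UA: "U1\<^sup>T * A \<in> carrier_mat b n" "U2\<^sup>T * A \<in> carrier_mat (m - b) n" using U1 U2 A by auto
  show both: "left_cols b U * (T11 * (left_cols b V)\<^sup>T + T12 * (right_cols b V)\<^sup>T) =
      left_cols b U * (left_cols b U)\<^sup>T * A"
  proof -
    have "T11 * V1\<^sup>T + T12 * V2\<^sup>T = U1\<^sup>T * A"
      using splitV'[OF UA(1)] unfolding T11 T12 by (simp add: mult_assoc_dim)
    then show ?thesis
      unfolding U1_def[symmetric] V1_def[symmetric] V2_def[symmetric] by (simp add: mult_assoc_dim)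
  qed
  have "A - left_cols b U * (left_cols b U)\<^sup>T * A = U2 * (U2\<^sup>T * A)"
    unfolding U1_def[symmetric] using A U1 U2
    by (intro minus_eq_of_add_eq) (auto simp: mult_assoc_dim splitU'[OF A])
  moreover have "U2\<^sup>T * A = T22 * V2\<^sup>T"
  proof -
    have "0\<^sub>m (m - b) n + T22 * V2\<^sup>T = U2\<^sup>T * A"
    proof -
      have "U2\<^sup>T * A * (V1 * V1\<^sup>T) = U2\<^sup>T * (A * V1) * V1\<^sup>T" by (simp add: mult_assoc_dim)
      also have "\<dots> = 0\<^sub>m (m - b) n" unfolding T21 using V1 by simp
      finally show ?thesis using splitV'[OF UA(2)] unfolding T22 by (simp add: mult_assoc_dim)
    qed
    then show ?thesis
      using left_add_zero_mat[of "T22 * V2\<^sup>T" "m - b" n] T22c V2 by auto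
  qed
  moreover have "spectral_norm (U2 * (U2\<^sup>T * A)) = spectral_norm (U2\<^sup>T * A)"
    by (rule spectral_norm_orthonormal_mult[OF U2 orth(1) UA(2)])
  moreover have "spectral_norm (T22 * V2\<^sup>T) = spectral_norm T22"
    by (rule spectral_norm_mult_transpose_orthonormal[OF V2 orth(2) T22c])
  ultimately show "spectral_norm (A - left_cols b U * (T11 * (left_cols b V)\<^sup>T + T12 * (right_cols b V)\<^sup>T)) =
      spectral_norm T22"
    unfolding both by simp
qed

text \<open>The two alternatives of the hypothesis are the almost sure outcomes of a Gaussian
  sample: either the two projectors agree, or both leave \<open>A\<close> unchanged.\<close>

lemma utv_sample_projection:
  assumes A: "A \<in> carrier_mat m n" and G: "G \<in> carrier_mat m b" and b: "b < min m n"
    and utv: "utv_step A b q G U T V"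
    and blocks: "split_block T b b = (T11, T12, T21, T22)"
    and Q: "orthonormal_basis_mat (sampling_mat A q G) Q"
    and generic: "trivial_kernel (sampling_mat A q G) \<or>
      (\<forall>v \<in> carrier_vec n. (sampling_mat A q G)\<^sup>T *\<^sub>v v = 0\<^sub>v b \<longrightarrow> A *\<^sub>v v = 0\<^sub>v m)"
  shows "A * Q * Q\<^sup>T = left_cols b U * T11 * (left_cols b V)\<^sup>T"
proof -
  let ?V1 = "left_cols b V"
  note Y = sampling_mat_carrier[OF A G, of q]
  obtain C where Qc: "Q \<in> carrier_mat n b" "orthonormal_mat Q"
    and C: "C \<in> carrier_mat b b" "sampling_mat A q G = Q * C"
    using orthonormal_basis_matD[OF Y Q] by blast
  obtain C' where C': "C' \<in> carrier_mat b b" "sampling_mat A q G = ?V1 * C'"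
    using utv_step_sample_factor[OF A G b utv] by blast
  have unitV: "unitary_mat n V" by (rule utv_step_factorization(2)[OF A G b utv])
  then have V1: "?V1 \<in> carrier_mat n b" "orthonormal_mat ?V1"
    using left_cols_carrier[of V n n b] unitary_col_blocks(1)[OF unitV, of b] b
    unfolding unitary_mat_def by auto
  from generic have "A * (Q * Q\<^sup>T) = A * (?V1 * ?V1\<^sup>T)"
  proof
    assume "trivial_kernel (sampling_mat A q G)"
    then show ?thesis using projector_unique[OF Y _ Qc C V1 C'] by simp
  next
    assume ker: "\<forall>v \<in> carrier_vec n. (sampling_mat A q G)\<^sup>T *\<^sub>v v = 0\<^sub>v b \<longrightarrow> A *\<^sub>v v = 0\<^sub>v m"
    have "A * (Q * Q\<^sup>T) = A"
      by (rule orthonormal_absorbs[OF A Qc C(1)]) (use ker in \<open>simp add: C(2)\<close>)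
    moreover have "A * (?V1 * ?V1\<^sup>T) = A"
      by (rule orthonormal_absorbs[OF A V1 C'(1)]) (use ker in \<open>simp add: C'(2)\<close>)
    ultimately show ?thesis by simp
  qed
  then show ?thesis
    using utv_left_approx[OF A G b utv blocks] A Qc(1) by (simp add: mult_assoc_dim)
qed

text \<open>\<open>Z = A * Y\<close> has full column rank and lies in the spans of both \<open>W\<close> and \<open>U\<^sub>1\<close>, the latter because
  \<open>A * V\<^sub>1 = U\<^sub>1 * T\<^sub>1\<^sub>1\<close>.\<close>

lemma utv_two_sided_approx:
  assumes A: "A \<in> carrier_mat m n" and G: "G \<in> carrier_mat m b" and b: "b < min m n"
    and utv: "utv_step A b q G U T V"
    and blocks: "split_block T b b = (T11, T12, T21, T22)"
    and W: "orthonormal_basis_mat (A * sampling_mat A q G) W"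
    and generic: "trivial_kernel (sampling_mat A q G)"
  shows "W * W\<^sup>T * A = left_cols b U * (T11 * (left_cols b V)\<^sup>T + T12 * (right_cols b V)\<^sup>T)"
proof -
  let ?U1 = "left_cols b U"
  note Y = sampling_mat_carrier[OF A G, of q]
  have Z: "A * sampling_mat A q G \<in> carrier_mat m b" using A Y by auto
  obtain C where Wc: "W \<in> carrier_mat m b" "orthonormal_mat W"
    and C: "C \<in> carrier_mat b b" "A * sampling_mat A q G = W * C"
    using orthonormal_basis_matD[OF Z W] by blast
  obtain C' where C': "C' \<in> carrier_mat b b" "sampling_mat A q G = left_cols b V * C'"
    using utv_step_sample_factor[OF A G b utv] by blast
  have unitU: "unitary_mat m U" and unitV: "unitary_mat n V"
    by (rule utv_step_factorization(1,2)[OF A G b utv])+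
  have U1: "?U1 \<in> carrier_mat m b" "orthonormal_mat ?U1" and V1: "left_cols b V \<in> carrier_mat n b"
    using left_cols_carrier[of U m m b] left_cols_carrier[of V n n b]
      unitary_col_blocks(1)[OF unitU, of b] b unitU unitV
    unfolding unitary_mat_def by auto
  have T11: "T11 \<in> carrier_mat b b" using blocks unfolding split_block_def Let_def by auto
  note [simp] = carrier_matD[OF A] carrier_matD[OF U1(1)] carrier_matD[OF V1]
    carrier_matD[OF C'(1)] carrier_matD[OF T11]
  have "A * sampling_mat A q G = A * left_cols b V * C'"
    unfolding C'(2) by (simp add: mult_assoc_dim)
  also have "\<dots> = ?U1 * (T11 * C')"
    unfolding utv_range[OF A G b utv blocks] by (simp add: mult_assoc_dim)
  finally have "A * sampling_mat A q G = ?U1 * (T11 * C')" .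
  moreover have "T11 * C' \<in> carrier_mat b b" using T11 C'(1) by auto
  ultimately have "W * W\<^sup>T = ?U1 * ?U1\<^sup>T"
    using projector_unique[OF Z trivial_kernel_mult_sampling_mat[OF A G generic] Wc C U1] by blast
  then show ?thesis unfolding utv_both_approx[OF A G b utv blocks] by simp
qed

lemma rsvd_approx:
  assumes A: "A \<in> carrier_mat m n" and Q: "Q \<in> carrier_mat n b" and rsvd: "rsvd A Q Ut Dt Vt"
  shows "Ut * Dt * Vt\<^sup>T = A * Q * Q\<^sup>T"
proof -
  from rsvd obtain S where svd: "thin_SVD (A * Q) Ut Dt S" and Vt: "Vt = Q * S"
    unfolding rsvd_def by blast
  have dims: "Ut \<in> carrier_mat m b" "Dt \<in> carrier_mat b b" "S \<in> carrier_mat b b"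
    and AQ: "A * Q = Ut * Dt * S\<^sup>T"
    using svd A Q unfolding thin_SVD_def unitary_mat_def by auto
  show ?thesis
    unfolding AQ Vt using dims Q by (simp add: mat_dim_simps)
qed

section \<open>Error identities for the UTV step\<close>

theorem theorem1:
  fixes M :: "'w measure" and G :: "'w \<Rightarrow> real mat" and A :: "real mat" and m n b q :: nat
  assumes "prob_space M"
    and "A \<in> carrier_mat m n"
    and "1 \<le> b" and "b < min m n"
    and "gaussian_mat M m b G"
  shows "AE \<omega> in M. \<forall>U T V U\<^sub>1 V\<^sub>1 V\<^sub>2 T\<^sub>1\<^sub>1 T\<^sub>1\<^sub>2 T\<^sub>2\<^sub>1 T\<^sub>2\<^sub>2.
    utv_step A b q (G \<omega>) U T V \<longrightarrow>
    U\<^sub>1 = left_cols b U \<longrightarrow>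
    V\<^sub>1 = left_cols b V \<longrightarrow> V\<^sub>2 = right_cols b V \<longrightarrow>
    split_block T b b = (T\<^sub>1\<^sub>1, T\<^sub>1\<^sub>2, T\<^sub>2\<^sub>1, T\<^sub>2\<^sub>2) \<longrightarrow>
    (\<forall>Q. orthonormal_basis_mat (sampling_mat A q (G \<omega>)) Q \<longrightarrow>
      (\<forall>Ut Dt Vt. rsvd A Q Ut Dt Vt \<longrightarrow>
        spectral_norm (A - A * Q * Q\<^sup>T) = spectral_norm (A - Ut * Dt * Vt\<^sup>T)) \<and>
      spectral_norm (A - A * Q * Q\<^sup>T) = spectral_norm (A - U\<^sub>1 * T\<^sub>1\<^sub>1 * V\<^sub>1\<^sup>T) \<and>
      spectral_norm (A - U\<^sub>1 * T\<^sub>1\<^sub>1 * V\<^sub>1\<^sup>T) = spectral_norm (T\<^sub>1\<^sub>2 @\<^sub>r T\<^sub>2\<^sub>2)) \<and>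
    (vec_space.rank m A \<ge> b \<longrightarrow>
      (\<forall>W. orthonormal_basis_mat (A * sampling_mat A q (G \<omega>)) W \<longrightarrow>
        spectral_norm (A - W * W\<^sup>T * A) =
          spectral_norm (A - U\<^sub>1 * (T\<^sub>1\<^sub>1 * V\<^sub>1\<^sup>T + T\<^sub>1\<^sub>2 * V\<^sub>2\<^sup>T)) \<and>
        spectral_norm (A - U\<^sub>1 * (T\<^sub>1\<^sub>1 * V\<^sub>1\<^sup>T + T\<^sub>1\<^sub>2 * V\<^sub>2\<^sup>T)) = spectral_norm T\<^sub>2\<^sub>2))"
proof -
  note A = assms(2) and b = assms(4)
  define P where "P = (A\<^sup>T * A) ^\<^sub>m q * A\<^sup>T"
  have P: "P \<in> carrier_mat n m" unfolding P_def using A by (intro carrier_matI) auto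
  have Y: "sampling_mat A q H = P * H" for H unfolding sampling_mat_def P_def by simp
  have ker: "A *\<^sub>v v = 0\<^sub>v m" if "v \<in> carrier_vec n" "P\<^sup>T *\<^sub>v v = 0\<^sub>v m" for v
    using kernel_sampling_transpose[OF A that(1)] that(2) unfolding P_def by blast
  have generic: "AE \<omega> in M. G \<omega> \<in> carrier_mat m b \<and>
    (trivial_kernel (sampling_mat A q (G \<omega>)) \<or>
      vec_space.rank m A < b \<and>
      (\<forall>v \<in> carrier_vec n. (sampling_mat A q (G \<omega>))\<^sup>T *\<^sub>v v = 0\<^sub>v b \<longrightarrow> A *\<^sub>v v = 0\<^sub>v m))"
  proof -
    have Gc: "AE \<omega> in M. G \<omega> \<in> carrier_mat m b"
      using assms(5) unfolding gaussian_mat_def by auto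
    from gaussian_sample_generic[OF assms(1,5) _ _ P] assms(3,4)
    consider (full) "AE \<omega> in M. trivial_kernel (P * G \<omega>)"
      | (deficient) k X where "k < b" "X \<in> carrier_mat n k" "trivial_kernel X"
        "\<forall>v \<in> carrier_vec n. X\<^sup>T *\<^sub>v v = 0\<^sub>v k \<longrightarrow> P\<^sup>T *\<^sub>v v = 0\<^sub>v m"
        "AE \<omega> in M. \<forall>v \<in> carrier_vec n. (P * G \<omega>)\<^sup>T *\<^sub>v v = 0\<^sub>v b \<longrightarrow> P\<^sup>T *\<^sub>v v = 0\<^sub>v m"
      by fastforce
    then show ?thesis
    proof cases
      case full
      then show ?thesis using Gc by eventually_elim (simp add: Y)
    next
      case deficient
      have "vec_space.rank m A \<le> k"
        by (rule rank_le_if_kernel_transpose_le[OF A deficient(2,3)]) (use deficient(4) ker in blast)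
      then have rank: "vec_space.rank m A < b" using deficient(1) by simp
      show ?thesis
        using deficient(5) Gc by eventually_elim (auto simp: Y rank intro!: ker)
    qed
  qed
  show ?thesis
    using generic
  proof eventually_elim
    case (elim \<omega>)
    then have G: "G \<omega> \<in> carrier_mat m b" by blast
    show ?case
    proof (intro allI impI conjI)
      fix U T V U\<^sub>1 V\<^sub>1 V\<^sub>2 T\<^sub>1\<^sub>1 T\<^sub>1\<^sub>2 T\<^sub>2\<^sub>1 T\<^sub>2\<^sub>2
      assume utv: "utv_step A b q (G \<omega>) U T V"
        and names: "U\<^sub>1 = left_cols b U" "V\<^sub>1 = left_cols b V" "V\<^sub>2 = right_cols b V"
        and blocks: "split_block T b b = (T\<^sub>1\<^sub>1, T\<^sub>1\<^sub>2, T\<^sub>2\<^sub>1, T\<^sub>2\<^sub>2)"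
      note utv_blocks = A G b utv blocks
      show "spectral_norm (A - U\<^sub>1 * T\<^sub>1\<^sub>1 * V\<^sub>1\<^sup>T) = spectral_norm (T\<^sub>1\<^sub>2 @\<^sub>r T\<^sub>2\<^sub>2)"
        unfolding names by (rule utv_error_left[OF utv_blocks])
      show "spectral_norm (A - U\<^sub>1 * (T\<^sub>1\<^sub>1 * V\<^sub>1\<^sup>T + T\<^sub>1\<^sub>2 * V\<^sub>2\<^sup>T)) = spectral_norm T\<^sub>2\<^sub>2"
        unfolding names by (rule utv_error_both[OF utv_blocks])
      show "spectral_norm (A - A * Q * Q\<^sup>T) = spectral_norm (A - U\<^sub>1 * T\<^sub>1\<^sub>1 * V\<^sub>1\<^sup>T)"
        if "orthonormal_basis_mat (sampling_mat A q (G \<omega>)) Q" for Q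
        using utv_sample_projection[OF utv_blocks that] elim unfolding names by auto
      show "spectral_norm (A - A * Q * Q\<^sup>T) = spectral_norm (A - Ut * Dt * Vt\<^sup>T)"
        if "orthonormal_basis_mat (sampling_mat A q (G \<omega>)) Q" "rsvd A Q Ut Dt Vt" for Q Ut Dt Vt
        using rsvd_approx[OF A _ that(2)] orthonormal_basis_matD(1)[OF sampling_mat_carrier[OF A G] that(1)]
        by simp
      show "spectral_norm (A - W * W\<^sup>T * A) =
          spectral_norm (A - U\<^sub>1 * (T\<^sub>1\<^sub>1 * V\<^sub>1\<^sup>T + T\<^sub>1\<^sub>2 * V\<^sub>2\<^sup>T))"
        if "b \<le> vec_space.rank m A" "orthonormal_basis_mat (A * sampling_mat A q (G \<omega>)) W" for W
      proof -
        have "trivial_kernel (sampling_mat A q (G \<omega>))" using elim that(1) by auto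
        then show ?thesis
          using utv_two_sided_approx[OF utv_blocks that(2)] unfolding names by simp
      qed
    qed
  qed
qed

end
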